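(* $\mathrm{CSP}(\mathbb{Q};\mathrm{X})$ is not expressible in FPC, where $\mathrm{X}=\{(x,y,z)\in\mathbb{Q}^3: x=y<z \text{ or } y=z<x \text{ or } z=x<y\}$.
   Context: For a structure $\mathfrak{B}$ with finite relational signature $\tau$, $\mathrm{CSP}(\mathfrak{B})$ is the class of finite $\tau$-structures admitting a homomorphism to $\mathfrak{B}$; it is expressible in FPC (fixed-point logic with counting) if some FPC sentence over $\tau$ holds exactly in those finite $\tau$-structures that admit no homomorphism to $\mathfrak{B}$. *)

theory Defs
  imports Complex_Main
begin

section \<open>Relational structures and CSPs\<close>

text \<open>A relational signature is a partial map from symbols to arities.\<close>

type_synonym 'r signature = "'r \<Rightarrow> nat option"

record ('r, 'a) rel_struct =
  universe :: "'a set"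
  interp :: "'r \<Rightarrow> 'a list set"

text \<open>Structures are non-empty, as is usual in finite model theory.\<close>

definition is_struct :: "'r signature \<Rightarrow> ('r, 'a) rel_struct \<Rightarrow> bool" where
  "is_struct \<tau> A \<longleftrightarrow> universe A \<noteq> {} \<and>
     (\<forall>R k. \<tau> R = Some k \<longrightarrow> interp A R \<subseteq> {xs. length xs = k \<and> set xs \<subseteq> universe A})"

definition finite_struct :: "'r signature \<Rightarrow> ('r, 'a) rel_struct \<Rightarrow> bool" where
  "finite_struct \<tau> A \<longleftrightarrow> is_struct \<tau> A \<and> finite (universe A)"

definition is_hom ::
  "'r signature \<Rightarrow> ('r, 'a) rel_struct \<Rightarrow> ('r, 'b) rel_struct \<Rightarrow> ('a \<Rightarrow> 'b) \<Rightarrow> bool" where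
  "is_hom \<tau> A B h \<longleftrightarrow> h ` universe A \<subseteq> universe B \<and>
     (\<forall>R k. \<tau> R = Some k \<longrightarrow> (\<forall>xs \<in> interp A R. map h xs \<in> interp B R))"

definition CSP :: "'r signature \<Rightarrow> ('r, 'b) rel_struct \<Rightarrow> ('r, 'a) rel_struct set" where
  "CSP \<tau> B = {A. finite_struct \<tau> A \<and> (\<exists>h. is_hom \<tau> A B h)}"

section \<open>Fixed-point logic with counting\<close>

text \<open>
  FPC is two-sorted: element variables range over the universe of a finite structure \<open>A\<close>,
  number variables over \<open>{0..n}\<close> with \<open>n\<close> the size of the universe.
  Every relation variable carries its type, the list of sorts of its arguments.
  The number terms are the number variables and the counting terms \<open>#x. \<phi>\<close>
  (\<open>x\<close> an element variable); \<open>Ifp X vs \<phi> ts\<close> is \<open>[ifp\<^bsub>X,vs\<^esub> \<phi>](ts)\<close>.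
\<close>

datatype srt = Elem | Num

datatype var = EVar nat | NVar nat

type_synonym rvar = "nat \<times> srt list"

datatype 'r trm =
    Var var
  | Count nat "'r fm"
and 'r fm =
    Eq "'r trm" "'r trm"
  | Le "'r trm" "'r trm"
  | Rel 'r "'r trm list"
  | RVar rvar "'r trm list"
  | Neg "'r fm"
  | Conj "'r fm" "'r fm"
  | Disj "'r fm" "'r fm"
  | Ex var "'r fm"
  | All var "'r fm"
  | Ifp rvar "var list" "'r fm" "'r trm list"

primrec var_srt :: "var \<Rightarrow> srt" where
  "var_srt (EVar x) = Elem"
| "var_srt (NVar x) = Num"

definition trm_srt :: "'r trm \<Rightarrow> srt" where
  "trm_srt t = (case t of Var v \<Rightarrow> var_srt v | Count x \<phi> \<Rightarrow> Num)"

fun wf_trm :: "'r signature \<Rightarrow> 'r trm \<Rightarrow> bool"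
  and wf_fm :: "'r signature \<Rightarrow> 'r fm \<Rightarrow> bool" where
  "wf_trm \<tau> (Var v) \<longleftrightarrow> True"
| "wf_trm \<tau> (Count x \<phi>) \<longleftrightarrow> wf_fm \<tau> \<phi>"
| "wf_fm \<tau> (Eq t u) \<longleftrightarrow> wf_trm \<tau> t \<and> wf_trm \<tau> u \<and> trm_srt t = trm_srt u"
| "wf_fm \<tau> (Le t u) \<longleftrightarrow> wf_trm \<tau> t \<and> wf_trm \<tau> u \<and> trm_srt t = Num \<and> trm_srt u = Num"
| "wf_fm \<tau> (Rel R ts) \<longleftrightarrow> \<tau> R = Some (length ts) \<and> (\<forall>t \<in> set ts. wf_trm \<tau> t \<and> trm_srt t = Elem)"
| "wf_fm \<tau> (RVar X ts) \<longleftrightarrow> map trm_srt ts = snd X \<and> (\<forall>t \<in> set ts. wf_trm \<tau> t)"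
| "wf_fm \<tau> (Neg \<phi>) \<longleftrightarrow> wf_fm \<tau> \<phi>"
| "wf_fm \<tau> (Conj \<phi> \<psi>) \<longleftrightarrow> wf_fm \<tau> \<phi> \<and> wf_fm \<tau> \<psi>"
| "wf_fm \<tau> (Disj \<phi> \<psi>) \<longleftrightarrow> wf_fm \<tau> \<phi> \<and> wf_fm \<tau> \<psi>"
| "wf_fm \<tau> (Ex v \<phi>) \<longleftrightarrow> wf_fm \<tau> \<phi>"
| "wf_fm \<tau> (All v \<phi>) \<longleftrightarrow> wf_fm \<tau> \<phi>"
| "wf_fm \<tau> (Ifp X vs \<phi> ts) \<longleftrightarrow> distinct vs \<and> map var_srt vs = snd X \<and> wf_fm \<tau> \<phi> \<and>
     map trm_srt ts = snd X \<and> (\<forall>t \<in> set ts. wf_trm \<tau> t)"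

fun fv_trm :: "'r trm \<Rightarrow> var set" and fv_fm :: "'r fm \<Rightarrow> var set" where
  "fv_trm (Var v) = {v}"
| "fv_trm (Count x \<phi>) = fv_fm \<phi> - {EVar x}"
| "fv_fm (Eq t u) = fv_trm t \<union> fv_trm u"
| "fv_fm (Le t u) = fv_trm t \<union> fv_trm u"
| "fv_fm (Rel R ts) = (\<Union>t \<in> set ts. fv_trm t)"
| "fv_fm (RVar X ts) = (\<Union>t \<in> set ts. fv_trm t)"
| "fv_fm (Neg \<phi>) = fv_fm \<phi>"
| "fv_fm (Conj \<phi> \<psi>) = fv_fm \<phi> \<union> fv_fm \<psi>"
| "fv_fm (Disj \<phi> \<psi>) = fv_fm \<phi> \<union> fv_fm \<psi>"
| "fv_fm (Ex v \<phi>) = fv_fm \<phi> - {v}"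
| "fv_fm (All v \<phi>) = fv_fm \<phi> - {v}"
| "fv_fm (Ifp X vs \<phi> ts) = (fv_fm \<phi> - set vs) \<union> (\<Union>t \<in> set ts. fv_trm t)"

fun frv_trm :: "'r trm \<Rightarrow> rvar set" and frv_fm :: "'r fm \<Rightarrow> rvar set" where
  "frv_trm (Var v) = {}"
| "frv_trm (Count x \<phi>) = frv_fm \<phi>"
| "frv_fm (Eq t u) = frv_trm t \<union> frv_trm u"
| "frv_fm (Le t u) = frv_trm t \<union> frv_trm u"
| "frv_fm (Rel R ts) = (\<Union>t \<in> set ts. frv_trm t)"
| "frv_fm (RVar X ts) = {X} \<union> (\<Union>t \<in> set ts. frv_trm t)"
| "frv_fm (Neg \<phi>) = frv_fm \<phi>"
| "frv_fm (Conj \<phi> \<psi>) = frv_fm \<phi> \<union> frv_fm \<psi>"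
| "frv_fm (Disj \<phi> \<psi>) = frv_fm \<phi> \<union> frv_fm \<psi>"
| "frv_fm (Ex v \<phi>) = frv_fm \<phi>"
| "frv_fm (All v \<phi>) = frv_fm \<phi>"
| "frv_fm (Ifp X vs \<phi> ts) = (frv_fm \<phi> - {X}) \<union> (\<Union>t \<in> set ts. frv_trm t)"

definition fpc_sentence :: "'r signature \<Rightarrow> 'r fm \<Rightarrow> bool" where
  "fpc_sentence \<tau> \<phi> \<longleftrightarrow> wf_fm \<tau> \<phi> \<and> fv_fm \<phi> = {} \<and> frv_fm \<phi> = {}"

datatype 'a val = VElem 'a | VNum nat

fun srt_dom :: "('r, 'a) rel_struct \<Rightarrow> srt \<Rightarrow> 'a val set" where
  "srt_dom A Elem = VElem ` universe A"
| "srt_dom A Num = VNum ` {0..card (universe A)}"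

text \<open>The stages \<open>S\<^sub>0 = {}\<close>, \<open>S\<^sub>i\<^sub>+\<^sub>1 = S\<^sub>i \<union> F S\<^sub>i\<close> become stationary after finitely many
  steps when \<open>F\<close> only produces subsets of a fixed finite set, which is the only case used.\<close>

definition inflationary_fp :: "('b set \<Rightarrow> 'b set) \<Rightarrow> 'b set" where
  "inflationary_fp F = (\<Union>i. ((\<lambda>S. S \<union> F S) ^^ i) {})"

definition upd_list :: "(var \<Rightarrow> 'v) \<Rightarrow> var list \<Rightarrow> 'v list \<Rightarrow> var \<Rightarrow> 'v" where
  "upd_list s vs ds v = (case map_of (zip vs ds) v of None \<Rightarrow> s v | Some d \<Rightarrow> d)"

fun eval_trm :: "('r, 'a) rel_struct \<Rightarrow> (rvar \<Rightarrow> 'a val list set) \<Rightarrow> (var \<Rightarrow> 'a val) \<Rightarrow> 'r trm \<Rightarrow> 'a val"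
  and sat :: "('r, 'a) rel_struct \<Rightarrow> (rvar \<Rightarrow> 'a val list set) \<Rightarrow> (var \<Rightarrow> 'a val) \<Rightarrow> 'r fm \<Rightarrow> bool" where
  "eval_trm A P s (Var v) = s v"
| "eval_trm A P s (Count x \<phi>) =
     VNum (card {a \<in> universe A. sat A P (s(EVar x := VElem a)) \<phi>})"
| "sat A P s (Eq t u) \<longleftrightarrow> eval_trm A P s t = eval_trm A P s u"
| "sat A P s (Le t u) \<longleftrightarrow> (\<exists>i j. eval_trm A P s t = VNum i \<and> eval_trm A P s u = VNum j \<and> i \<le> j)"
| "sat A P s (Rel R ts) \<longleftrightarrow> (\<exists>xs \<in> interp A R. map (eval_trm A P s) ts = map VElem xs)"
| "sat A P s (RVar X ts) \<longleftrightarrow> map (eval_trm A P s) ts \<in> P X"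
| "sat A P s (Neg \<phi>) \<longleftrightarrow> \<not> sat A P s \<phi>"
| "sat A P s (Conj \<phi> \<psi>) \<longleftrightarrow> sat A P s \<phi> \<and> sat A P s \<psi>"
| "sat A P s (Disj \<phi> \<psi>) \<longleftrightarrow> sat A P s \<phi> \<or> sat A P s \<psi>"
| "sat A P s (Ex v \<phi>) \<longleftrightarrow> (\<exists>d \<in> srt_dom A (var_srt v). sat A P (s(v := d)) \<phi>)"
| "sat A P s (All v \<phi>) \<longleftrightarrow> (\<forall>d \<in> srt_dom A (var_srt v). sat A P (s(v := d)) \<phi>)"
| "sat A P s (Ifp X vs \<phi> ts) \<longleftrightarrow>
     map (eval_trm A P s) ts \<in> inflationary_fp (\<lambda>S.
       {ds. list_all2 (\<lambda>v d. d \<in> srt_dom A (var_srt v)) vs ds \<and>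
            sat A (P(X := S)) (upd_list s vs ds) \<phi>})"

text \<open>For sentences, satisfaction does not depend on the assignments.\<close>

definition models :: "('r, 'a) rel_struct \<Rightarrow> 'r fm \<Rightarrow> bool" where
  "models A \<phi> \<longleftrightarrow> (\<forall>P s. sat A P s \<phi>)"

text \<open>Every finite structure is isomorphic to one whose universe is a set of natural numbers,
  so it suffices to quantify over the latter.\<close>

definition CSP_expressible_in_FPC :: "'r signature \<Rightarrow> ('r, 'b) rel_struct \<Rightarrow> bool" where
  "CSP_expressible_in_FPC \<tau> B \<longleftrightarrow>
     (\<exists>\<phi>. fpc_sentence \<tau> \<phi> \<and>
        (\<forall>A :: ('r, nat) rel_struct. finite_struct \<tau> A \<longrightarrow> (models A \<phi> \<longleftrightarrow> A \<notin> CSP \<tau> B)))"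

section \<open>The structure \<open>(\<rat>; X)\<close>\<close>

datatype X_symbol = X_sym

definition X_sig :: "X_symbol signature" where
  "X_sig = [X_sym \<mapsto> 3]"

definition QX :: "(X_symbol, rat) rel_struct" where
  "QX = \<lparr>universe = UNIV,
         interp = (\<lambda>_. {[x, y, z] | x y z. (x = y \<and> y < z) \<or> (y = z \<and> z < x) \<or> (z = x \<and> x < y)})\<rparr>"

end

(* Minimal elements of a solution of a QX-instance form the support of a nonzero solution of a
   homogeneous linear system over the two-element field. Take a nonsingular system with three
   variables per equation and no small cycles (obtained from the group Z/4 by repeated lifts along
   2-groups, which preserve nonsingularity), and homogenise, in the style of Cai, Fuerer and Immerman,
   the inhomogeneous system "all equations hold, and x_p = b". For b = 0 the instance is solvable, for
   b = 1 it is not. Small sets of equations have boundaries at least as large as themselves, so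
   Duplicator can play the bijective pebble game between the two instances by keeping an assignment
   that respects every sum of few equations supported on the pebbled variables; hence no FPC sentence
   tells them apart. *)
theory Submission
  imports Defs "HOL-Library.Countable"
begin

section \<open>Pebble games and FPC\<close>

text \<open>Two demands pull against each other. The equation x_p = 1 must look harmless locally,
  which calls for sparse small sets of equations, yet it must be refuted globally, which calls for a
  kernel that is exactly zero. A lift along a 2-group opens cycles without creating kernel vectors:
  in characteristic two, the sum of a solution and its translate by an involution is a solution
  invariant under that involution. The passage from linear equations to \<open>QX\<close> loses
  information. A homomorphism yields a solution modulo two, but a solution need not yield a
  homomorphism, since three non-minimal values must again satisfy X. Hence only the zero solution is
  ever realised, by an explicit map, and the other instance is refuted using the safe direction
  alone.\<close>

abbreviation val_related :: "('a \<times> 'b) set \<Rightarrow> 'a val \<Rightarrow> 'b val \<Rightarrow> bool" where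
  "val_related r \<equiv> rel_val (\<lambda>a b. (a, b) \<in> r)"

text \<open>Bounds the pebbles added to a position during evaluation. A fixed point pays once for
  its tuple, however many stages it takes, because the stages are compared one at a time.\<close>

fun pebbles_trm :: "'r trm \<Rightarrow> nat" and pebbles_fm :: "'r fm \<Rightarrow> nat" where
  "pebbles_trm (Var v) = 0"
| "pebbles_trm (Count x \<phi>) = Suc (pebbles_fm \<phi>)"
| "pebbles_fm (Eq t u) = pebbles_trm t + pebbles_trm u"
| "pebbles_fm (Le t u) = pebbles_trm t + pebbles_trm u"
| "pebbles_fm (Rel R ts) = (\<Sum>t\<leftarrow>ts. pebbles_trm t)"
| "pebbles_fm (RVar X ts) = (\<Sum>t\<leftarrow>ts. pebbles_trm t)"
| "pebbles_fm (Neg \<phi>) = pebbles_fm \<phi>"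
| "pebbles_fm (Conj \<phi> \<psi>) = pebbles_fm \<phi> + pebbles_fm \<psi>"
| "pebbles_fm (Disj \<phi> \<psi>) = pebbles_fm \<phi> + pebbles_fm \<psi>"
| "pebbles_fm (Ex v \<phi>) = Suc (pebbles_fm \<phi>)"
| "pebbles_fm (All v \<phi>) = Suc (pebbles_fm \<phi>)"
| "pebbles_fm (Ifp X vs \<phi> ts) = length vs + pebbles_fm \<phi> + (\<Sum>t\<leftarrow>ts. pebbles_trm t)"

lemma pebbles_trm_le: "t \<in> set ts \<Longrightarrow> pebbles_trm t \<le> (\<Sum>t\<leftarrow>ts. pebbles_trm t)"
  by (rule member_le_sum_list) auto

lemma val_related_mono: "val_related r d d' \<Longrightarrow> r \<subseteq> r' \<Longrightarrow> val_related r' d d'"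
  by (erule val.rel_mono_strong) blast

text \<open>One pair suffices for each element entry, and numbers need none. This is what trims a
  position to the budget in the fixed-point case.\<close>

lemma val_related_list_support:
  assumes "list_all2 (val_related r) ds ds'"
  shows "\<exists>q\<subseteq>r. finite q \<and> card q \<le> length ds \<and> list_all2 (val_related q) ds ds'"
  using assms
proof (induction rule: list_all2_induct)
  case Nil
  then show ?case by (intro exI[of _ "{}"]) auto
next
  case (Cons d ds d' ds')
  then obtain q where q: "q \<subseteq> r" "finite q" "card q \<le> length ds" "list_all2 (val_related q) ds ds'"
    by blast
  show ?case
    using Cons.hyps(1)
  proof (cases rule: val.rel_cases)
    case (VElem a b)
    have "list_all2 (val_related (insert (a, b) q)) ds ds'"
      by (rule list_all2_mono[OF q(4)]) (erule val_related_mono, blast)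
    then show ?thesis
      using q VElem by (intro exI[of _ "insert (a, b) q"]) (auto simp: card_insert_if)
  next
    case (VNum i j)
    then show ?thesis using q by (intro exI[of _ q]) auto
  qed
qed

lemma upd_list_Cons: "upd_list s (v # vs) (d # ds) = (upd_list s vs ds)(v := d)"
  by (auto simp: upd_list_def fun_eq_iff)

lemma upd_list_rel:
  assumes "list_all2 R ds ds'" "length vs = length ds" "v \<notin> set vs \<Longrightarrow> R (s v) (s' v)"
  shows "R (upd_list s vs ds v) (upd_list s' vs ds' v)"
  using assms
proof (induction arbitrary: vs rule: list_all2_induct)
  case Nil
  then show ?case by (simp add: upd_list_def)
next
  case (Cons d ds d' ds')
  then obtain w ws where "vs = w # ws" by (cases vs) auto
  with Cons show ?case by (auto simp: upd_list_Cons)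
qed

lemma inflationary_fp_transfer:
  assumes "\<And>S S'. R S S' \<Longrightarrow> R (S \<union> F S) (S' \<union> F' S')" "R {} {}"
    and "\<And>S S'. (\<And>i. R (S i) (S' i)) \<Longrightarrow> R (\<Union>i::nat. S i) (\<Union>i. S' i)"
  shows "R (inflationary_fp F) (inflationary_fp F')"
proof -
  have "R (((\<lambda>S. S \<union> F S) ^^ i) {}) (((\<lambda>S. S \<union> F' S) ^^ i) {})" for i
    by (induction i) (use assms(1,2) in auto)
  then show ?thesis unfolding inflationary_fp_def by (rule assms(3))
qed

lemma bij_betw_Collect_iff:
  assumes "bij_betw g X Y" "\<And>d. d \<in> X \<Longrightarrow> Q d \<longleftrightarrow> Q' (g d)"
  shows "bij_betw g {d \<in> X. Q d} {d \<in> Y. Q' d}"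
  unfolding bij_betw_def
proof
  show "inj_on g {d \<in> X. Q d}" using assms(1) by (auto simp: bij_betw_def inj_on_def)
  show "g ` {d \<in> X. Q d} = {d \<in> Y. Q' d}" using assms by (auto simp: bij_betw_def)
qed

section \<open>The bijective pebble game and the invariance of FPC under it\<close>

text \<open>Positions of the bijective pebble game are the sets of pebbled pairs; \<open>ext\<close> is Duplicator's
  answer to a move, available as long as fewer than \<open>K\<close> pairs are pebbled.\<close>

locale pebble_game =
  fixes A :: "('r, 'a) rel_struct" and B :: "('r, 'b) rel_struct"
    and Pos :: "('a \<times> 'b) set set" and K :: nat
  assumes same_card: "card (universe A) = card (universe B)"
    and empty: "{} \<in> Pos"
    and finite_position: "r \<in> Pos \<Longrightarrow> finite r"
    and sub: "r \<in> Pos \<Longrightarrow> q \<subseteq> r \<Longrightarrow> q \<in> Pos"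
    and in_universe: "r \<in> Pos \<Longrightarrow> r \<subseteq> universe A \<times> universe B"
    and injective: "r \<in> Pos \<Longrightarrow> (a, b) \<in> r \<Longrightarrow> (a', b') \<in> r \<Longrightarrow> a = a' \<longleftrightarrow> b = b'"
    and preserves: "r \<in> Pos \<Longrightarrow> list_all2 (\<lambda>a b. (a, b) \<in> r) xs ys \<Longrightarrow>
      xs \<in> interp A R \<longleftrightarrow> ys \<in> interp B R"
    and ext: "r \<in> Pos \<Longrightarrow> card r < K \<Longrightarrow>
      \<exists>f. bij_betw f (universe A) (universe B) \<and> (\<forall>a\<in>universe A. insert (a, f a) r \<in> Pos)"
begin

text \<open>Relations need only be respected by positions above a fixed \<open>p\<close>: in the evaluation of a fixed
  point, \<open>p\<close> holds the values of its parameters, which stay pebbled when their variables are reused.\<close>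

definition similar :: "('a \<times> 'b) set \<Rightarrow> 'a val list set \<Rightarrow> 'b val list set \<Rightarrow> bool" where
  "similar p S S' \<longleftrightarrow> (\<forall>r\<in>Pos. p \<subseteq> r \<longrightarrow>
     (\<forall>ds ds'. list_all2 (val_related r) ds ds' \<longrightarrow> (ds \<in> S \<longleftrightarrow> ds' \<in> S')))"

lemma similar_mono: "similar p S S' \<Longrightarrow> p \<subseteq> r \<Longrightarrow> similar r S S'"
  unfolding similar_def by (meson order_trans)

lemma similarD: "similar r S S' \<Longrightarrow> r \<in> Pos \<Longrightarrow> list_all2 (val_related r) ds ds' \<Longrightarrow> ds \<in> S \<longleftrightarrow> ds' \<in> S'"
  unfolding similar_def by blast

lemma related_eq_iff:
  assumes "r \<in> Pos" "val_related r x x'" "val_related r y y'"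
  shows "x = y \<longleftrightarrow> x' = y'"
  using assms(2,3) injective[OF assms(1)] by (auto elim!: val.rel_cases)

lemma related_num: "val_related r x x' \<Longrightarrow> x = VNum i \<longleftrightarrow> x' = VNum i"
  by (auto elim!: val.rel_cases)

lemma related_dom:
  assumes "r \<in> Pos" "val_related r d d'"
  shows "d \<in> srt_dom A \<sigma> \<longleftrightarrow> d' \<in> srt_dom B \<sigma>"
  using assms(2) in_universe[OF assms(1)] same_card by (cases \<sigma>) (auto elim!: val.rel_cases)

lemma related_dom_list:
  assumes "r \<in> Pos" "list_all2 (val_related r) ds ds'"
  shows "list_all2 (\<lambda>v d. d \<in> srt_dom A (var_srt v)) vs ds \<longleftrightarrow>
    list_all2 (\<lambda>v d. d \<in> srt_dom B (var_srt v)) vs ds'"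
  using assms(2)
proof (induction arbitrary: vs rule: list_all2_induct)
  case (Cons d ds d' ds')
  then show ?case using related_dom[OF assms(1) Cons.hyps(1)] by (cases vs) auto
qed simp

lemma related_rel:
  assumes "r \<in> Pos" "list_all2 (val_related r) ds ds'"
  shows "(\<exists>xs\<in>interp A R. ds = map VElem xs) \<longleftrightarrow> (\<exists>xs\<in>interp B R. ds' = map VElem xs)"
proof -
  have 1: "\<exists>ys. ds' = map VElem ys \<and> list_all2 (\<lambda>a b. (a, b) \<in> r) xs ys" if "ds = map VElem xs" for xs
  proof (intro exI[of _ "map (\<lambda>d. case d of VElem a \<Rightarrow> a) ds'"] conjI)
    have *: "list_all2 (\<lambda>a d. \<exists>b. d = VElem b \<and> (a, b) \<in> r) xs ds'"
      using assms(2) unfolding that list.rel_map by (rule list_all2_mono) (auto elim: val.rel_cases)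
    then show "ds' = map VElem (map (\<lambda>d. case d of VElem a \<Rightarrow> a) ds')"
      by (induction rule: list_all2_induct) auto
    show "list_all2 (\<lambda>a b. (a, b) \<in> r) xs (map (\<lambda>d. case d of VElem a \<Rightarrow> a) ds')"
      using * unfolding list.rel_map by (rule list_all2_mono) auto
  qed
  have 2: "\<exists>xs. ds = map VElem xs \<and> list_all2 (\<lambda>a b. (a, b) \<in> r) xs ys" if "ds' = map VElem ys" for ys
  proof (intro exI[of _ "map (\<lambda>d. case d of VElem a \<Rightarrow> a) ds"] conjI)
    have *: "list_all2 (\<lambda>d b. \<exists>a. d = VElem a \<and> (a, b) \<in> r) ds ys"
      using assms(2) unfolding that list.rel_map by (rule list_all2_mono) (auto elim: val.rel_cases)
    then show "ds = map VElem (map (\<lambda>d. case d of VElem a \<Rightarrow> a) ds)"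
      by (induction rule: list_all2_induct) auto
    show "list_all2 (\<lambda>a b. (a, b) \<in> r) (map (\<lambda>d. case d of VElem a \<Rightarrow> a) ds) ys"
      using * unfolding list.rel_map by (rule list_all2_mono) auto
  qed
  show ?thesis using 1 2 preserves[OF assms(1)] by metis
qed

text \<open>The position is quantified inside, so that the induction hypothesis applies after
  further moves. Only free variables are tied to it, which leaves variables about to be rebound
  arbitrary.\<close>

definition trm_inv :: "'r trm \<Rightarrow> bool" where
  "trm_inv t \<longleftrightarrow> (\<forall>r P P' s s'. r \<in> Pos \<longrightarrow> card r + pebbles_trm t \<le> K \<longrightarrow>
     (\<forall>v\<in>fv_trm t. val_related r (s v) (s' v)) \<longrightarrow> (\<forall>X\<in>frv_trm t. similar r (P X) (P' X)) \<longrightarrow>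
     val_related r (eval_trm A P s t) (eval_trm B P' s' t))"

definition fm_inv :: "'r fm \<Rightarrow> bool" where
  "fm_inv \<phi> \<longleftrightarrow> (\<forall>r P P' s s'. r \<in> Pos \<longrightarrow> card r + pebbles_fm \<phi> \<le> K \<longrightarrow>
     (\<forall>v\<in>fv_fm \<phi>. val_related r (s v) (s' v)) \<longrightarrow> (\<forall>X\<in>frv_fm \<phi>. similar r (P X) (P' X)) \<longrightarrow>
     (sat A P s \<phi> \<longleftrightarrow> sat B P' s' \<phi>))"

lemma trm_invD:
  assumes "trm_inv t" "r \<in> Pos" "card r + pebbles_trm t \<le> K"
    "\<And>v. v \<in> fv_trm t \<Longrightarrow> val_related r (s v) (s' v)"
    "\<And>X. X \<in> frv_trm t \<Longrightarrow> similar r (P X) (P' X)"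
  shows "val_related r (eval_trm A P s t) (eval_trm B P' s' t)"
  using assms unfolding trm_inv_def by blast

lemma fm_invD:
  assumes "fm_inv \<phi>" "r \<in> Pos" "card r + pebbles_fm \<phi> \<le> K"
    "\<And>v. v \<in> fv_fm \<phi> \<Longrightarrow> val_related r (s v) (s' v)"
    "\<And>X. X \<in> frv_fm \<phi> \<Longrightarrow> similar r (P X) (P' X)"
  shows "sat A P s \<phi> \<longleftrightarrow> sat B P' s' \<phi>"
  using assms unfolding fm_inv_def by blast

lemma trm_list_inv:
  assumes "\<And>t. t \<in> set ts \<Longrightarrow> trm_inv t" "r \<in> Pos" "card r + (\<Sum>t\<leftarrow>ts. pebbles_trm t) \<le> K"
    "\<And>v. v \<in> (\<Union>t\<in>set ts. fv_trm t) \<Longrightarrow> val_related r (s v) (s' v)"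
    "\<And>X. X \<in> (\<Union>t\<in>set ts. frv_trm t) \<Longrightarrow> similar r (P X) (P' X)"
  shows "list_all2 (val_related r) (map (eval_trm A P s) ts) (map (eval_trm B P' s') ts)"
proof -
  have "val_related r (eval_trm A P s t) (eval_trm B P' s' t)" if t: "t \<in> set ts" for t
  proof -
    have 1: "card r + pebbles_trm t \<le> K" using pebbles_trm_le[OF t] assms(3) by linarith
    have 2: "val_related r (s v) (s' v)" if "v \<in> fv_trm t" for v
      by (rule assms(4)) (use that t in blast)
    have 3: "similar r (P X) (P' X)" if "X \<in> frv_trm t" for X
      by (rule assms(5)) (use that t in blast)
    show ?thesis by (rule trm_invD[OF assms(1)[OF t] assms(2) 1 2 3])
  qed
  then show ?thesis by (simp add: list_all2_conv_all_nth)
qed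

lemma extended_position:
  assumes "r \<in> Pos" "card r < K"
  obtains f where "bij_betw f (universe A) (universe B)"
    "\<And>a. a \<in> universe A \<Longrightarrow> insert (a, f a) r \<in> Pos"
    "\<And>a. card (insert (a, f a) r) \<le> Suc (card r)"
proof -
  obtain f where "bij_betw f (universe A) (universe B)" "\<forall>a\<in>universe A. insert (a, f a) r \<in> Pos"
    using ext[OF assms] by blast
  then show ?thesis using that finite_position[OF assms(1)] by (simp add: card_insert_if)
qed

lemma fm_inv_step:
  assumes "fm_inv \<phi>" "r \<in> Pos" "q \<in> Pos" "r \<subseteq> q" "card q + pebbles_fm \<phi> \<le> K"
    "\<And>w. w \<in> fv_fm \<phi> \<Longrightarrow> w \<noteq> v \<Longrightarrow> val_related r (s w) (s' w)" "val_related q d d'"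
    "\<And>X. X \<in> frv_fm \<phi> \<Longrightarrow> similar r (P X) (P' X)"
  shows "sat A P (s(v := d)) \<phi> \<longleftrightarrow> sat B P' (s'(v := d')) \<phi>"
proof (rule fm_invD[OF assms(1,3,5)])
  show "val_related q ((s(v := d)) w) ((s'(v := d')) w)" if "w \<in> fv_fm \<phi>" for w
  proof (cases "w = v")
    case False
    show ?thesis using val_related_mono[OF assms(6)[OF that False] assms(4)] False by simp
  qed (use assms(7) in simp)
  show "similar q (P X) (P' X)" if "X \<in> frv_fm \<phi>" for X
    by (rule similar_mono[OF assms(8)[OF that] assms(4)])
qed

text \<open>One bijection serves all three binders: counting uses that it preserves the number of
  satisfying values, \<open>Ex\<close> and \<open>All\<close> that its image is the whole
  domain.\<close>

lemma quantifier_transfer: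
  assumes "fm_inv \<phi>" "r \<in> Pos" "card r + Suc (pebbles_fm \<phi>) \<le> K"
    "\<And>w. w \<in> fv_fm \<phi> \<Longrightarrow> w \<noteq> v \<Longrightarrow> val_related r (s w) (s' w)"
    "\<And>X. X \<in> frv_fm \<phi> \<Longrightarrow> similar r (P X) (P' X)"
  shows "\<exists>g. bij_betw g (srt_dom A (var_srt v)) (srt_dom B (var_srt v)) \<and>
    (\<forall>d\<in>srt_dom A (var_srt v). sat A P (s(v := d)) \<phi> \<longleftrightarrow> sat B P' (s'(v := g d)) \<phi>)"
proof -
  have "card r < K" using assms(3) by simp
  then obtain f where f: "bij_betw f (universe A) (universe B)"
    "\<And>a. a \<in> universe A \<Longrightarrow> insert (a, f a) r \<in> Pos"
    "\<And>a. card (insert (a, f a) r) \<le> Suc (card r)"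
    using extended_position[OF assms(2)] by metis
  show ?thesis
  proof (cases v)
    case (EVar x)
    have "bij_betw (map_val f) (VElem ` universe A) (VElem ` universe B)"
    proof -
      have "map_val f ` VElem ` universe A = VElem ` f ` universe A" by (simp add: image_image)
      then show ?thesis using f(1) by (simp add: bij_betw_def inj_on_def)
    qed
    moreover have "sat A P (s(v := VElem a)) \<phi> \<longleftrightarrow> sat B P' (s'(v := VElem (f a))) \<phi>"
      if "a \<in> universe A" for a
    proof (rule fm_inv_step[OF assms(1,2) f(2)[OF that]])
      show "card (insert (a, f a) r) + pebbles_fm \<phi> \<le> K" using f(3)[of a] assms(3) by linarith
    qed (use assms(4,5) in auto)
    ultimately show ?thesis using EVar by (intro exI[of _ "map_val f"]) auto
  next
    case (NVar x)
    have "sat A P (s(v := VNum i)) \<phi> \<longleftrightarrow> sat B P' (s'(v := VNum i)) \<phi>" for i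
      by (rule fm_inv_step[OF assms(1,2,2)]) (use assms(3-5) in auto)
    \<comment> \<open>\<open>map_val f\<close> fixes numbers, so a number is answered by itself and
      no pebble is placed.\<close>
    moreover have "bij_betw (map_val f) (VNum ` {0..card (universe A)}) (VNum ` {0..card (universe B)})"
      by (auto simp: bij_betw_def inj_on_def image_image same_card)
    ultimately show ?thesis using NVar by (intro exI[of _ "map_val f"]) auto
  qed
qed

lemma trm_inv: "trm_inv (t :: 'r trm)" and fm_inv: "fm_inv (\<phi> :: 'r fm)"
proof (induction t and \<phi> rule: trm.induct fm.induct)
  case (Var v)
  then show ?case by (auto simp: trm_inv_def)
next
  case (Count x \<phi>)
  show ?case
    unfolding trm_inv_def
  proof (intro allI impI)
    fix r P P' s s'
    assume *: "r \<in> Pos" "card r + pebbles_trm (Count x \<phi>) \<le> K"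
      "\<forall>v\<in>fv_trm (Count x \<phi>). val_related r (s v) (s' v)"
      "\<forall>X\<in>frv_trm (Count x \<phi>). similar r (P X) (P' X)"
    obtain g where g: "bij_betw g (srt_dom A Elem) (srt_dom B Elem)"
      "\<And>d. d \<in> srt_dom A Elem \<Longrightarrow>
         sat A P (s(EVar x := d)) \<phi> \<longleftrightarrow> sat B P' (s'(EVar x := g d)) \<phi>"
      using quantifier_transfer[OF Count *(1), of "EVar x" s s' P P'] *(2-4) by auto
    have "bij_betw g {d \<in> srt_dom A Elem. sat A P (s(EVar x := d)) \<phi>}
      {d \<in> srt_dom B Elem. sat B P' (s'(EVar x := d)) \<phi>}"
      by (rule bij_betw_Collect_iff) (fact g)+
    then have eq: "card {d \<in> srt_dom A Elem. sat A P (s(EVar x := d)) \<phi>} =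
      card {d \<in> srt_dom B Elem. sat B P' (s'(EVar x := d)) \<phi>}"
      by (rule bij_betw_same_card)
    have elem: "card {d \<in> VElem ` U. Q d} = card {a \<in> U. Q (VElem a)}" for U :: "'c set" and Q
    proof -
      have "{d \<in> VElem ` U. Q d} = VElem ` {a \<in> U. Q (VElem a)}" by auto
      then show ?thesis by (simp add: card_image inj_on_def)
    qed
    show "val_related r (eval_trm A P s (Count x \<phi>)) (eval_trm B P' s' (Count x \<phi>))"
      using eq by (simp add: elem)
  qed
next
  case (Eq t u)
  show ?case
    unfolding fm_inv_def
  proof (intro allI impI)
    fix r P P' s s'
    assume *: "r \<in> Pos" "card r + pebbles_fm (Eq t u) \<le> K"
      "\<forall>v\<in>fv_fm (Eq t u). val_related r (s v) (s' v)"
      "\<forall>X\<in>frv_fm (Eq t u). similar r (P X) (P' X)"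
    show "sat A P s (Eq t u) = sat B P' s' (Eq t u)"
      using related_eq_iff[OF *(1) trm_invD[OF Eq(1) *(1)] trm_invD[OF Eq(2) *(1)], of s s' P P' s s' P P']
        *(2-4) by auto
  qed
next
  case (Le t u)
  show ?case
    unfolding fm_inv_def
  proof (intro allI impI)
    fix r P P' s s'
    assume *: "r \<in> Pos" "card r + pebbles_fm (Le t u) \<le> K"
      "\<forall>v\<in>fv_fm (Le t u). val_related r (s v) (s' v)"
      "\<forall>X\<in>frv_fm (Le t u). similar r (P X) (P' X)"
    show "sat A P s (Le t u) = sat B P' s' (Le t u)"
      using related_num[OF trm_invD[OF Le(1) *(1)], of s s' P P']
        related_num[OF trm_invD[OF Le(2) *(1)], of s s' P P'] *(2-4) by auto
  qed
next
  case (Rel R ts)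
  show ?case
    unfolding fm_inv_def
  proof (intro allI impI)
    fix r P P' s s'
    assume *: "r \<in> Pos" "card r + pebbles_fm (Rel R ts) \<le> K"
      "\<forall>v\<in>fv_fm (Rel R ts). val_related r (s v) (s' v)"
      "\<forall>X\<in>frv_fm (Rel R ts). similar r (P X) (P' X)"
    show "sat A P s (Rel R ts) = sat B P' s' (Rel R ts)"
      using related_rel[OF *(1) trm_list_inv[OF Rel *(1)], of ts s s' P P' R] *(2-4) by simp
  qed
next
  case (RVar X ts)
  show ?case
    unfolding fm_inv_def
  proof (intro allI impI)
    fix r P P' s s'
    assume *: "r \<in> Pos" "card r + pebbles_fm (RVar X ts) \<le> K"
      "\<forall>v\<in>fv_fm (RVar X ts). val_related r (s v) (s' v)"
      "\<forall>X\<in>frv_fm (RVar X ts). similar r (P X) (P' X)"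
    have "similar r (P X) (P' X)" using *(4) by simp
    from similarD[OF this *(1) trm_list_inv[OF RVar *(1)], of ts s s' P P']
    show "sat A P s (RVar X ts) = sat B P' s' (RVar X ts)"
      using *(2-4) by simp
  qed
next
  case (Neg \<phi>)
  then show ?case by (simp add: fm_inv_def)
next
  case (Conj \<phi> \<psi>)
  show ?case
    unfolding fm_inv_def
  proof (intro allI impI)
    fix r P P' s s'
    assume *: "r \<in> Pos" "card r + pebbles_fm (Conj \<phi> \<psi>) \<le> K"
      "\<forall>v\<in>fv_fm (Conj \<phi> \<psi>). val_related r (s v) (s' v)"
      "\<forall>X\<in>frv_fm (Conj \<phi> \<psi>). similar r (P X) (P' X)"
    show "sat A P s (Conj \<phi> \<psi>) = sat B P' s' (Conj \<phi> \<psi>)"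
      using fm_invD[OF Conj(1) *(1), of s s' P P'] fm_invD[OF Conj(2) *(1), of s s' P P'] *(2-4) by auto
  qed
next
  case (Disj \<phi> \<psi>)
  show ?case
    unfolding fm_inv_def
  proof (intro allI impI)
    fix r P P' s s'
    assume *: "r \<in> Pos" "card r + pebbles_fm (Disj \<phi> \<psi>) \<le> K"
      "\<forall>v\<in>fv_fm (Disj \<phi> \<psi>). val_related r (s v) (s' v)"
      "\<forall>X\<in>frv_fm (Disj \<phi> \<psi>). similar r (P X) (P' X)"
    show "sat A P s (Disj \<phi> \<psi>) = sat B P' s' (Disj \<phi> \<psi>)"
      using fm_invD[OF Disj(1) *(1), of s s' P P'] fm_invD[OF Disj(2) *(1), of s s' P P'] *(2-4) by auto
  qed
next
  case (Ex v \<phi>)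
  show ?case
    unfolding fm_inv_def
  proof (intro allI impI)
    fix r P P' s s'
    assume *: "r \<in> Pos" "card r + pebbles_fm (Ex v \<phi>) \<le> K"
      "\<forall>v\<in>fv_fm (Ex v \<phi>). val_related r (s v) (s' v)"
      "\<forall>X\<in>frv_fm (Ex v \<phi>). similar r (P X) (P' X)"
    obtain g where "bij_betw g (srt_dom A (var_srt v)) (srt_dom B (var_srt v))"
      "\<And>d. d \<in> srt_dom A (var_srt v) \<Longrightarrow> sat A P (s(v := d)) \<phi> \<longleftrightarrow> sat B P' (s'(v := g d)) \<phi>"
      using quantifier_transfer[OF Ex *(1), of v s s' P P'] *(2-4) by auto
    moreover from this(1) have "srt_dom B (var_srt v) = g ` srt_dom A (var_srt v)"
      by (simp add: bij_betw_def)
    ultimately show "sat A P s (Ex v \<phi>) = sat B P' s' (Ex v \<phi>)" by auto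
  qed
next
  case (All v \<phi>)
  show ?case
    unfolding fm_inv_def
  proof (intro allI impI)
    fix r P P' s s'
    assume *: "r \<in> Pos" "card r + pebbles_fm (All v \<phi>) \<le> K"
      "\<forall>v\<in>fv_fm (All v \<phi>). val_related r (s v) (s' v)"
      "\<forall>X\<in>frv_fm (All v \<phi>). similar r (P X) (P' X)"
    obtain g where "bij_betw g (srt_dom A (var_srt v)) (srt_dom B (var_srt v))"
      "\<And>d. d \<in> srt_dom A (var_srt v) \<Longrightarrow> sat A P (s(v := d)) \<phi> \<longleftrightarrow> sat B P' (s'(v := g d)) \<phi>"
      using quantifier_transfer[OF All *(1), of v s s' P P'] *(2-4) by auto
    moreover from this(1) have "srt_dom B (var_srt v) = g ` srt_dom A (var_srt v)"
      by (simp add: bij_betw_def)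
    ultimately show "sat A P s (All v \<phi>) = sat B P' s' (All v \<phi>)" by auto
  qed
next
  case (Ifp X vs \<phi> ts)
  show ?case
    unfolding fm_inv_def
  proof (intro allI impI)
    fix r P P' s s'
    assume *: "r \<in> Pos" "card r + pebbles_fm (Ifp X vs \<phi> ts) \<le> K"
      "\<forall>v\<in>fv_fm (Ifp X vs \<phi> ts). val_related r (s v) (s' v)"
      "\<forall>Y\<in>frv_fm (Ifp X vs \<phi> ts). similar r (P Y) (P' Y)"
    let ?F = "\<lambda>S. {ds. list_all2 (\<lambda>v d. d \<in> srt_dom A (var_srt v)) vs ds \<and>
            sat A (P(X := S)) (upd_list s vs ds) \<phi>}"
    let ?F' = "\<lambda>S. {ds. list_all2 (\<lambda>v d. d \<in> srt_dom B (var_srt v)) vs ds \<and>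
            sat B (P'(X := S)) (upd_list s' vs ds) \<phi>}"
    have "similar r (inflationary_fp ?F) (inflationary_fp ?F')"
    proof (rule inflationary_fp_transfer)
      fix S S' assume S: "similar r S S'"
      have "ds \<in> S \<union> ?F S \<longleftrightarrow> ds' \<in> S' \<union> ?F' S'"
        if q: "q \<in> Pos" "r \<subseteq> q" and ds: "list_all2 (val_related q) ds ds'" for q ds ds'
      proof (cases "length ds = length vs")
        case True
        \<comment> \<open>\<open>q\<close> may exceed the budget. The tuple needs at most
          \<open>length vs\<close> of its pairs; together with \<open>r\<close>, which carries the
          parameters, they form a position within the budget.\<close>
        obtain q' where q': "q' \<subseteq> q" "finite q'" "card q' \<le> length ds" "list_all2 (val_related q') ds ds'"
          using val_related_list_support[OF ds] by blast
        have "r \<union> q' \<in> Pos" using sub[OF q(1)] q(2) q'(1) by simp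
        moreover have "card (r \<union> q') + pebbles_fm \<phi> \<le> K"
          using card_Un_le[of r q'] q'(3) True *(2) by simp
        moreover have "val_related (r \<union> q') (upd_list s vs ds v) (upd_list s' vs ds' v)"
          if "v \<in> fv_fm \<phi>" for v
        proof (rule upd_list_rel)
          show "list_all2 (val_related (r \<union> q')) ds ds'"
            by (rule list_all2_mono[OF q'(4)]) (erule val_related_mono, blast)
          show "val_related (r \<union> q') (s v) (s' v)" if "v \<notin> set vs"
            by (rule val_related_mono[of r]) (use *(3) that \<open>v \<in> fv_fm \<phi>\<close> in auto)
        qed (use True in simp)
        moreover have "similar (r \<union> q') ((P(X := S)) Y) ((P'(X := S')) Y)" if "Y \<in> frv_fm \<phi>" for Y
          by (rule similar_mono[of r]) (use S *(4) that in auto)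
        ultimately have "sat A (P(X := S)) (upd_list s vs ds) \<phi> \<longleftrightarrow>
            sat B (P'(X := S')) (upd_list s' vs ds') \<phi>"
          by (rule fm_invD[OF Ifp(1)])
        moreover have "ds \<in> S \<longleftrightarrow> ds' \<in> S'" using S q ds unfolding similar_def by blast
        ultimately show ?thesis using related_dom_list[OF q(1) ds] by simp
      next
        case False
        then show ?thesis
          using S q ds list_all2_lengthD[OF ds] unfolding similar_def by (auto dest: list_all2_lengthD)
      qed
      then show "similar r (S \<union> ?F S) (S' \<union> ?F' S')" unfolding similar_def by blast
    qed (auto simp: similar_def)
    moreover have "list_all2 (val_related r) (map (eval_trm A P s) ts) (map (eval_trm B P' s') ts)"
      by (rule trm_list_inv[OF Ifp(2) *(1)]) (use *(2-4) in auto)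
    ultimately show "sat A P s (Ifp X vs \<phi> ts) = sat B P' s' (Ifp X vs \<phi> ts)"
      using similarD[OF _ *(1)] by simp
  qed
qed

theorem models_iff:
  assumes "fpc_sentence \<tau> \<phi>" "pebbles_fm \<phi> \<le> K"
  shows "models A \<phi> \<longleftrightarrow> models B \<phi>"
proof -
  have "sat A P s \<phi> \<longleftrightarrow> sat B P' s' \<phi>" for P s P' s'
    by (rule fm_invD[OF fm_inv empty])
      (use assms in \<open>auto simp: fpc_sentence_def\<close>)
  then show ?thesis unfolding models_def by blast
qed

end

section \<open>Triple systems over the two-element field\<close>

definition neighbours :: "('v \<Rightarrow> nat \<Rightarrow> 'v) \<Rightarrow> 'v \<Rightarrow> 'v set" where
  "neighbours a t = a t ` {..<3}"

text \<open>A triple system is read as the homogeneous linear system with the equations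
  \<open>x\<^bsub>a t 0\<^esub> + x\<^bsub>a t 1\<^esub> + x\<^bsub>a t 2\<^esub> = 0\<close> for \<open>t \<in> V\<close>; equations and variables share the index set \<open>V\<close>.\<close>

definition triple_system :: "'v set \<Rightarrow> ('v \<Rightarrow> nat \<Rightarrow> 'v) \<Rightarrow> bool" where
  "triple_system V a \<longleftrightarrow> finite V \<and> V \<noteq> {} \<and> (\<forall>t\<in>V. neighbours a t \<subseteq> V \<and> inj_on (a t) {..<3})"

definition nonsingular :: "'v set \<Rightarrow> ('v \<Rightarrow> nat \<Rightarrow> 'v) \<Rightarrow> bool" where
  "nonsingular V a \<longleftrightarrow>
     (\<forall>x. (\<forall>t\<in>V. x (a t 2) \<longleftrightarrow> x (a t 0) \<noteq> x (a t 1)) \<longrightarrow> (\<forall>v\<in>V. \<not> x v))"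

definition shared :: "('v \<Rightarrow> nat \<Rightarrow> 'v) \<Rightarrow> 'v set \<Rightarrow> 'v \<Rightarrow> 'v set" where
  "shared a Y t = {v \<in> neighbours a t. \<exists>s\<in>Y. s \<noteq> t \<and> v \<in> neighbours a s}"

definition leaf :: "('v \<Rightarrow> nat \<Rightarrow> 'v) \<Rightarrow> 'v set \<Rightarrow> 'v \<Rightarrow> bool" where
  "leaf a Y t \<longleftrightarrow> (\<exists>u. shared a Y t \<subseteq> {u})"

text \<open>Two leaves, as in any forest with at least two nodes: when a set is cut at a vertex and
  one leaf is lost at the cut, another remains.\<close>

definition two_leaves :: "('v \<Rightarrow> nat \<Rightarrow> 'v) \<Rightarrow> 'v set \<Rightarrow> bool" where
  "two_leaves a Y \<longleftrightarrow> (\<exists>t\<in>Y. \<exists>u\<in>Y. t \<noteq> u \<and> leaf a Y t \<and> leaf a Y u)"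

text \<open>Stands in for the absence of short cycles: the equations of a simple cycle each share
  two vertices with the others, so none of them is a leaf. Bounding \<open>card Y\<close> makes the
  later inductions run on cardinalities.\<close>

definition locally_forest :: "nat \<Rightarrow> 'v set \<Rightarrow> ('v \<Rightarrow> nat \<Rightarrow> 'v) \<Rightarrow> bool" where
  "locally_forest n V a \<longleftrightarrow> (\<forall>Y\<subseteq>V. 2 \<le> card Y \<longrightarrow> card Y \<le> n \<longrightarrow> two_leaves a Y)"

lemma not_leaf_other:
  assumes "\<not> leaf a Y t"
  shows "\<exists>v. v \<noteq> w \<and> v \<in> neighbours a t \<and> (\<exists>s\<in>Y. s \<noteq> t \<and> v \<in> neighbours a s)"
  using assms unfolding leaf_def shared_def by blast

abbreviation symmetric_difference :: "'b set \<Rightarrow> 'b set \<Rightarrow> 'b set" (infixl "\<triangle>" 65) where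
  "X \<triangle> Y \<equiv> (X - Y) \<union> (Y - X)"

text \<open>Read for labels that agree after one step each: \<open>f\<close> and \<open>g\<close>
  differ at \<open>e\<close> exactly if one of the two steps, but not both, uses
  \<open>e\<close>.\<close>

lemma toggle_eqD:
  "f \<triangle> {d} = g \<triangle> {d'} \<Longrightarrow> ((e \<in> f) \<noteq> (e = d)) = ((e \<in> g) \<noteq> (e = d'))"
  by (drule eqset_imp_iff[of _ _ e]) auto

section \<open>The parity lift: opening cycles while keeping the kernel zero\<close>

text \<open>The lift of a triple system whose vertices record the set of incidences \<open>(t, i)\<close> traversed an odd
  number of times. A closed walk of the lift projects to one using each incidence an even number of
  times, so short cycles of \<open>V\<close> are opened up. Up to renaming, the lift lives on
  \<open>V \<times> Pow (V \<times> {..<3})\<close>; \<open>pt\<close> and \<open>lab\<close> are the two projections.\<close>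

locale parity_lift =
  fixes V :: "'v set" and a :: "'v \<Rightarrow> nat \<Rightarrow> 'v"
    and W :: "'w set" and b :: "'w \<Rightarrow> nat \<Rightarrow> 'w"
    and pt :: "'w \<Rightarrow> 'v" and lab :: "'w \<Rightarrow> ('v \<times> nat) set"
  assumes base: "triple_system V a"
    and pt_lab: "bij_betw (\<lambda>x. (pt x, lab x)) W (V \<times> Pow (V \<times> {..<3}))"
    and b_in: "x \<in> W \<Longrightarrow> i < 3 \<Longrightarrow> b x i \<in> W"
    and pt_b: "x \<in> W \<Longrightarrow> i < 3 \<Longrightarrow> pt (b x i) = a (pt x) i"
    and lab_b: "x \<in> W \<Longrightarrow> i < 3 \<Longrightarrow> lab (b x i) = lab x \<triangle> {(pt x, i)}"
begin

lemma pt_in: "x \<in> W \<Longrightarrow> pt x \<in> V"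
  using pt_lab by (auto simp: bij_betw_def)

lemma W_eqI: "x \<in> W \<Longrightarrow> y \<in> W \<Longrightarrow> pt x = pt y \<Longrightarrow> lab x = lab y \<Longrightarrow> x = y"
  using pt_lab by (auto simp: bij_betw_def inj_on_def)

lemma base_inj: "t \<in> V \<Longrightarrow> i < 3 \<Longrightarrow> j < 3 \<Longrightarrow> a t i = a t j \<Longrightarrow> i = j"
  using base by (auto simp: triple_system_def inj_on_def)

lemma lift_inj: "x \<in> W \<Longrightarrow> i < 3 \<Longrightarrow> j < 3 \<Longrightarrow> b x i = b x j \<Longrightarrow> i = j"
  using base_inj[OF pt_in] pt_b by metis

lemma lift_triple_system: "triple_system W b"
proof -
  have "finite (V \<times> Pow (V \<times> {..<3::nat}))" "V \<times> Pow (V \<times> {..<3::nat}) \<noteq> {}"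
    using base by (auto simp: triple_system_def)
  then have "finite W" "W \<noteq> {}"
    using bij_betw_finite[OF pt_lab] pt_lab by (auto simp: bij_betw_def)
  then show ?thesis
    using lift_inj b_in by (auto simp: triple_system_def neighbours_def inj_on_def)
qed

text \<open>Over the same equation a common vertex is reached by the same incidence, and undoing one
  and the same toggle makes the labels equal. Hence sharing upstairs projects to sharing
  downstairs.\<close>

lemma common_pt:
  assumes "x \<in> W" "y \<in> W" "x \<noteq> y" "w \<in> neighbours b x" "w \<in> neighbours b y"
  shows "pt x \<noteq> pt y"
proof
  assume eq: "pt x = pt y"
  obtain i j where ij: "i < 3" "j < 3" "w = b x i" "w = b y j"
    using assms(4,5) by (auto simp: neighbours_def)
  then have "a (pt x) i = a (pt x) j" using pt_b[OF assms(1)] pt_b[OF assms(2)] eq by metis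
  then have "i = j" using base_inj[OF pt_in[OF assms(1)]] ij by blast
  moreover have "lab x \<triangle> {(pt x, i)} = lab y \<triangle> {(pt y, j)}"
    using ij lab_b[OF assms(1)] lab_b[OF assms(2)] by metis
  ultimately have "lab x = lab y" using eq toggle_eqD[of "lab x" _ "lab y"] by auto
  then show False using W_eqI assms(1-3) eq by blast
qed

lemma pt_neighbours: "x \<in> W \<Longrightarrow> w \<in> neighbours b x \<Longrightarrow> pt w \<in> neighbours a (pt x)"
  by (auto simp: neighbours_def pt_b)

lemma neighbours_pt_inj:
  assumes "x \<in> W" "w \<in> neighbours b x" "w' \<in> neighbours b x" "pt w = pt w'"
  shows "w = w'"
proof -
  obtain i j where ij: "i < 3" "j < 3" "w = b x i" "w' = b x j"
    using assms(2,3) by (auto simp: neighbours_def)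
  then have "a (pt x) i = a (pt x) j" using assms(1,4) by (simp add: pt_b)
  then have "i = j" using base_inj[OF pt_in[OF assms(1)] ij(1,2)] by blast
  then show ?thesis using ij by simp
qed

text \<open>\<open>pt\<close> keeps sharing and is injective around each equation, so two shared
  vertices upstairs would give two downstairs.\<close>

lemma leaf_lift:
  assumes "Y \<subseteq> W" "x \<in> Y" "leaf a (pt ` Y) (pt x)"
  shows "leaf b Y x"
proof (rule ccontr)
  assume *: "\<not> leaf b Y x"
  obtain w where w: "w \<in> neighbours b x" "\<exists>y\<in>Y. y \<noteq> x \<and> w \<in> neighbours b y"
    using not_leaf_other[OF *, of x] by blast
  obtain w' where w': "w' \<noteq> w" "w' \<in> neighbours b x" "\<exists>y\<in>Y. y \<noteq> x \<and> w' \<in> neighbours b y"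
    using not_leaf_other[OF *, of w] by blast
  have "pt v \<in> shared a (pt ` Y) (pt x)"
    if v: "v \<in> neighbours b x" "\<exists>y\<in>Y. y \<noteq> x \<and> v \<in> neighbours b y" for v
  proof -
    obtain y where y: "y \<in> Y" "y \<noteq> x" "v \<in> neighbours b y" using v(2) by blast
    have "x \<in> W" "y \<in> W" using assms(1,2) y(1) by auto
    then have "pt v \<in> neighbours a (pt x)" "pt v \<in> neighbours a (pt y)" "pt y \<noteq> pt x"
      using pt_neighbours v(1) y(2,3) common_pt[of y x v] by auto
    then show ?thesis unfolding shared_def using y(1) by blast
  qed
  then have "pt w = pt w'" using w w' assms(3) unfolding leaf_def by blast
  then show False using neighbours_pt_inj w w' assms(1,2) by blast
qed

lemma two_leaves_small_image:
  assumes "locally_forest n V a" "Y \<subseteq> W" "2 \<le> card Y" "card (pt ` Y) \<le> n"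
  shows "two_leaves b Y"
proof (cases "card (pt ` Y) \<le> 1")
  case True
  have "finite Y" by (rule card_ge_0_finite) (use assms(3) in simp)
  have "card (pt ` Y) \<le> Suc 0" using True by simp
  then have eq: "\<forall>x\<in>pt ` Y. \<forall>y\<in>pt ` Y. x = y"
    unfolding card_le_Suc0_iff_eq[OF finite_imageI[OF \<open>finite Y\<close>]] .
  \<comment> \<open>All of \<open>Y\<close> lies over one equation, so by \<open>common_pt\<close>
    its members share no vertex at all.\<close>
  have "leaf b Y x" if x: "x \<in> Y" for x
  proof (rule ccontr)
    assume "\<not> leaf b Y x"
    from not_leaf_other[OF this, of x] obtain w y where
      "w \<in> neighbours b x" "y \<in> Y" "y \<noteq> x" "w \<in> neighbours b y" by blast
    moreover from this have "pt y = pt x" using eq x by blast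
    ultimately show False using common_pt[of y x w] x assms(2) by blast
  qed
  moreover have "\<not> card Y \<le> Suc 0" using assms(3) by simp
  ultimately show ?thesis
    unfolding card_le_Suc0_iff_eq[OF \<open>finite Y\<close>] two_leaves_def by blast
next
  case False
  have "pt ` Y \<subseteq> V" using assms(2) pt_in by blast
  then have "two_leaves a (pt ` Y)"
    using False assms(1,4) unfolding locally_forest_def by simp
  then obtain x y where "x \<in> Y" "y \<in> Y" "pt x \<noteq> pt y" "leaf a (pt ` Y) (pt x)" "leaf a (pt ` Y) (pt y)"
    unfolding two_leaves_def by blast
  moreover from this have "leaf b Y x" "leaf b Y y" "x \<noteq> y" using leaf_lift[OF assms(2)] by auto
  ultimately show ?thesis unfolding two_leaves_def by blast
qed

lemma two_leaves_subset:
  assumes "locally_forest n V a" "Y \<subseteq> W" "card Y \<le> Suc n" "Q \<subset> Y" "2 \<le> card Q"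
  shows "two_leaves b Q"
proof (rule two_leaves_small_image[OF assms(1) _ assms(5)])
  have "finite W" using lift_triple_system by (simp add: triple_system_def)
  then have "finite Y" using assms(2) finite_subset by blast
  then have "card Q \<le> n" using psubset_card_mono[OF _ assms(4)] assms(3) by simp
  then show "card (pt ` Q) \<le> n"
    using card_image_le[of Q pt] finite_subset[OF psubset_imp_subset[OF assms(4)] \<open>finite Y\<close>] by simp
qed (use assms in blast)

text \<open>If \<open>Y\<close> has at most one leaf, take a non-leaf \<open>r\<close> with a shared vertex \<open>w = b r i\<close>, and split \<open>Y\<close>
  according to membership of \<open>(pt r, i)\<close> in the label. When \<open>pt\<close> is injective on \<open>Y\<close>, the two parts
  meet only in the vertex \<open>w\<close> of \<open>r\<close>, so one of them violates the bound for smaller sets.\<close>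

lemma two_leaves_inj_image:
  assumes forest: "locally_forest n V a" and Y: "Y \<subseteq> W" "card Y \<le> Suc n" "2 \<le> card Y"
    and inj: "inj_on pt Y"
  shows "two_leaves b Y"
proof (rule ccontr)
  assume no: "\<not> two_leaves b Y"
  have "Y \<noteq> {}" using Y(3) by auto
  \<comment> \<open>\<open>l\<close> is the only leaf, or an arbitrary element if there is
    none.\<close>
  then obtain l where l: "l \<in> Y" "\<And>x. x \<in> Y \<Longrightarrow> x \<noteq> l \<Longrightarrow> \<not> leaf b Y x"
    using no unfolding two_leaves_def by blast
  have "Y \<noteq> {l}" using Y(3) by auto
  then obtain r where r: "r \<in> Y" "r \<noteq> l" using l(1) by blast
  obtain w s where w: "w \<in> neighbours b r" and s: "s \<in> Y" "s \<noteq> r" "w \<in> neighbours b s"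
    using not_leaf_other[OF l(2)[OF r], of r] by blast
  obtain i where i: "i < 3" "w = b r i" using w by (auto simp: neighbours_def)
  obtain j where j: "j < 3" "w = b s j" using s(3) by (auto simp: neighbours_def)
  have inW: "x \<in> W" if "x \<in> Y" for x using that Y(1) by blast
  let ?e = "(pt r, i)"
  define Z where "Z = {x \<in> Y. ?e \<in> lab x \<longleftrightarrow> ?e \<in> lab r}"
  have rZ: "r \<in> Z" using r by (simp add: Z_def)
  have "pt s \<noteq> pt r" using inj r(1) s(1,2) by (auto simp: inj_on_def)
  moreover have "lab r \<triangle> {?e} = lab s \<triangle> {(pt s, j)}"
    using i j lab_b inW r(1) s(1) by metis
  ultimately have "(?e \<in> lab s) \<noteq> (?e \<in> lab r)" using toggle_eqD[of "lab r" ?e _ _ ?e] by auto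
  then have sZ: "s \<in> Y - Z" using s(1) by (simp add: Z_def)
  \<comment> \<open>A vertex shared across the cut forces one of the two steps to use
    \<open>?e\<close>. As \<open>pt\<close> is injective on \<open>Y\<close>, the equation taking
    that step is \<open>r\<close>, which lies in \<open>Z\<close>.\<close>
  have cross: "x = r \<and> v = w"
    if x: "x \<in> Z" and y: "y \<in> Y - Z" and v: "v \<in> neighbours b x" "v \<in> neighbours b y" for x y v
  proof -
    obtain k where k: "k < 3" "v = b x k" using v(1) by (auto simp: neighbours_def)
    obtain m where m: "m < 3" "v = b y m" using v(2) by (auto simp: neighbours_def)
    have xy: "x \<in> Y" "y \<in> Y" "x \<in> W" "y \<in> W" using x y inW by (auto simp: Z_def)
    have "lab x \<triangle> {(pt x, k)} = lab y \<triangle> {(pt y, m)}"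
      using k m lab_b xy(3,4) by metis
    moreover have "(?e \<in> lab x) \<noteq> (?e \<in> lab y)" using x y by (auto simp: Z_def)
    ultimately have "?e = (pt x, k) \<or> ?e = (pt y, m)" using toggle_eqD[of "lab x" _ _ _ ?e] by blast
    then show ?thesis
    proof
      assume "?e = (pt x, k)"
      then have "x = r" "k = i" using inj xy(1) r(1) by (auto simp: inj_on_def)
      then show ?thesis using k i by simp
    next
      assume "?e = (pt y, m)"
      then have "y = r" using inj xy(2) r(1) by (auto simp: inj_on_def)
      then show ?thesis using rZ y by blast
    qed
  qed
  have card2: "2 \<le> card Q" if "x \<in> Q" "y \<in> Q" "x \<noteq> y" "Q \<subseteq> Y" for x y Q
  proof -
    have "finite Y" by (rule card_ge_0_finite) (use Y(3) in simp)
    then have "finite Q" using that(4) finite_subset by blast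
    then have "\<not> card Q \<le> Suc 0" unfolding card_le_Suc0_iff_eq[OF \<open>finite Q\<close>] using that(1-3) by blast
    then show ?thesis by simp
  qed
  show False
  proof (cases "l \<in> Z")
    \<comment> \<open>\<open>Y - Z\<close> has two leaves, neither of which is a leaf of
      \<open>Y\<close>; so both must contain \<open>w\<close>, the only vertex met from
      \<open>Z\<close>. But then \<open>w\<close> is already shared inside \<open>Y - Z\<close>, and
      the cut hid nothing from them.\<close>
    case True
    let ?Q = "Y - Z"
    have "s \<noteq> l" using True sZ by blast
    then obtain v y where v: "v \<noteq> w" "v \<in> neighbours b s" "y \<in> Y" "y \<noteq> s" "v \<in> neighbours b y"
      using not_leaf_other[OF l(2)[OF s(1)], of w] by blast
    then have "y \<in> ?Q" using cross[OF _ sZ] by blast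
    then have "two_leaves b ?Q"
      using card2[of s ?Q y] sZ v(4) two_leaves_subset[OF forest Y(1,2)] rZ r(1) by blast
    then obtain t u where tu: "t \<in> ?Q" "u \<in> ?Q" "t \<noteq> u" "leaf b ?Q t" "leaf b ?Q u"
      unfolding two_leaves_def by blast
    have sub: "shared b Y x \<subseteq> shared b ?Q x \<union> {w}" if "x \<in> ?Q" for x
      using cross[OF _ that] unfolding shared_def by blast
    have wx: "w \<in> neighbours b x" if x: "x \<in> ?Q" "leaf b ?Q x" for x
    proof (rule ccontr)
      assume "w \<notin> neighbours b x"
      then have "shared b Y x \<subseteq> shared b ?Q x" using sub[OF x(1)] unfolding shared_def by blast
      then have "leaf b Y x" using x(2) unfolding leaf_def by blast
      then show False using l(2)[of x] x(1) True by blast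
    qed
    have "w \<in> neighbours b t" "w \<in> neighbours b u" using wx tu by simp_all
    then have "w \<in> shared b ?Q t" unfolding shared_def using tu(2,3) by auto
    then have "shared b Y t \<subseteq> {w}" using sub[OF tu(1)] tu(4) unfolding leaf_def by blast
    then show False using l(2)[of t] tu(1) True unfolding leaf_def by blast
  next
    \<comment> \<open>Only \<open>r\<close> meets the other side, so a leaf of \<open>Z\<close>
      other than \<open>r\<close> stays a leaf in \<open>Y\<close>.\<close>
    case False
    obtain v y where v: "v \<noteq> w" "v \<in> neighbours b r" "y \<in> Y" "y \<noteq> r" "v \<in> neighbours b y"
      using not_leaf_other[OF l(2)[OF r], of w] by blast
    then have "y \<in> Z" using cross[OF rZ] by blast
    moreover have "Z \<subset> Y" using sZ by (auto simp: Z_def)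
    ultimately have "two_leaves b Z"
      using card2[of r Z y] rZ v(4) two_leaves_subset[OF forest Y(1,2)] by blast
    then obtain t where t: "t \<in> Z" "t \<noteq> r" "leaf b Z t" unfolding two_leaves_def by metis
    then have "shared b Y t \<subseteq> shared b Z t"
      using cross[OF t(1)] unfolding shared_def by blast
    then have "leaf b Y t" using t(3) unfolding leaf_def by blast
    then show False using l(2)[of t] t(1) False \<open>Z \<subset> Y\<close> by blast
  qed
qed

text \<open>The gain of one: a set of \<open>Suc n\<close> equations either shrinks under
  \<open>pt\<close>, and the old bound applies to its image, or projects injectively and is cut in
  two.\<close>

lemma lift_locally_forest:
  assumes "locally_forest n V a"
  shows "locally_forest (Suc n) W b"
  unfolding locally_forest_def
proof (intro allI impI)
  fix Y assume Y: "Y \<subseteq> W" "2 \<le> card Y" "card Y \<le> Suc n"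
  show "two_leaves b Y"
  proof (cases "inj_on pt Y")
    case True
    then show ?thesis using two_leaves_inj_image[OF assms Y(1,3,2)] by blast
  next
    case False
    have "finite Y" by (rule card_ge_0_finite) (use Y(2) in simp)
    then have "card (pt ` Y) < card Y"
      using False card_image_le[of Y pt] eq_card_imp_inj_on[of Y pt] by linarith
    then show ?thesis using two_leaves_small_image[OF assms Y(1,2)] Y(3) by simp
  qed
qed

text \<open>If \<open>y\<close> is a solution, so is the sum of \<open>y\<close> and its translate by \<open>e\<close>, which is moreover invariant
  under translation by \<open>e\<close>. Hence a nonzero solution would yield a nonzero one invariant under all
  translations, which descends to \<open>V\<close>.\<close>

lemma flip_invariant_zero:
  fixes y :: "'v \<Rightarrow> ('v \<times> nat) set \<Rightarrow> bool"
  assumes ns: "nonsingular V a" and "finite D" "D \<subseteq> V \<times> {..<3}"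
    and "\<And>t f. t \<in> V \<Longrightarrow> f \<subseteq> V \<times> {..<3} \<Longrightarrow> y (a t 2) (f \<triangle> {(t, 2)}) \<longleftrightarrow>
      y (a t 0) (f \<triangle> {(t, 0)}) \<noteq> y (a t 1) (f \<triangle> {(t, 1)})"
    and "\<And>e v f. e \<in> V \<times> {..<3} - D \<Longrightarrow> v \<in> V \<Longrightarrow> f \<subseteq> V \<times> {..<3} \<Longrightarrow> y v (f \<triangle> {e}) = y v f"
    and "v \<in> V" "f \<subseteq> V \<times> {..<3}"
  shows "\<not> y v f"
  using assms(2-)
proof (induction D arbitrary: y v f rule: finite_induct)
  case empty
  let ?E = "V \<times> {..<3::nat}"
  have aV: "a t i \<in> V" if "t \<in> V" "i < 3" for t i
    using base that by (auto simp: triple_system_def neighbours_def)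
  have const: "y v g = y v {}" if "v \<in> V" "g \<subseteq> ?E" for v g
  proof -
    have "finite g" using base that(2) finite_subset by (fastforce simp: triple_system_def)
    then show ?thesis using that(2)
    proof (induction g rule: finite_induct)
      case (insert e g)
      then have "insert e g = g \<triangle> {e}" by auto
      then show ?case using empty(3)[of e v g] insert that(1) by simp
    qed simp
  qed
  have "y (a t 2) {} \<longleftrightarrow> y (a t 0) {} \<noteq> y (a t 1) {}" if t: "t \<in> V" for t
    using empty(2)[of t "{}"] const[OF aV[OF t], of 0 "{(t, 0)}"] const[OF aV[OF t], of 1 "{(t, 1)}"]
      const[OF aV[OF t], of 2 "{(t, 2)}"] t by simp
  then have "\<not> y v {}" using ns[unfolded nonsingular_def, rule_format, of "\<lambda>v. y v {}" v] empty(4) by blast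
  then show ?case using const empty by blast
next
  case (insert e D)
  let ?E = "V \<times> {..<3::nat}"
  have swap: "f \<triangle> {d} \<triangle> {d'} = f \<triangle> {d'} \<triangle> {d}" for f and d d' :: "'v \<times> nat" by auto
  have cancel: "f \<triangle> {d} \<triangle> {d} = f" for f and d :: "'v \<times> nat" by auto
  have e: "e \<in> ?E" and D: "D \<subseteq> ?E" using insert.prems(1) by auto
  have flip: "f \<triangle> {e} \<subseteq> ?E" if "f \<subseteq> ?E" for f using that e by auto
  \<comment> \<open>The sum of \<open>y\<close> and its translate by \<open>e\<close>. The induction
    hypothesis is used twice: on \<open>?y\<close>, whose vanishing says that \<open>y\<close> is
    invariant under \<open>e\<close>, and then on \<open>y\<close> itself.\<close>
  let ?y = "\<lambda>v f. y v f \<noteq> y v (f \<triangle> {e})"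
  have "\<not> ?y v f" if "v \<in> V" "f \<subseteq> ?E" for v f
  proof (rule insert.IH[OF D _ _ that])
    fix t f assume t: "t \<in> V" "f \<subseteq> ?E"
    show "?y (a t 2) (f \<triangle> {(t, 2)}) \<longleftrightarrow> ?y (a t 0) (f \<triangle> {(t, 0)}) \<noteq> ?y (a t 1) (f \<triangle> {(t, 1)})"
      using insert.prems(2)[OF t] insert.prems(2)[OF t(1) flip[OF t(2)]] by (simp only: swap[of f e]) blast
  next
    fix d v f assume d: "d \<in> ?E - D" "v \<in> V" "f \<subseteq> ?E"
    show "?y v (f \<triangle> {d}) = ?y v f"
    proof (cases "d = e")
      case True
      then show ?thesis using cancel[of f e] by auto
    next
      case False
      then show ?thesis
        using insert.prems(3)[of d v f] insert.prems(3)[of d v "f \<triangle> {e}"] d flip[OF d(3)]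
        by (simp only: swap[of f d]) blast
    qed
  qed
  then have inv: "y v (f \<triangle> {e}) = y v f" if "v \<in> V" "f \<subseteq> ?E" for v f using that by blast
  show ?case
  proof (rule insert.IH[OF D insert.prems(2) _ insert.prems(4,5)])
    fix d v f assume "d \<in> ?E - D" "v \<in> V" "f \<subseteq> ?E"
    then show "y v (f \<triangle> {d}) = y v f" using inv insert.prems(3) by (cases "d = e") auto
  qed
qed

lemma lift_nonsingular:
  assumes "nonsingular V a"
  shows "nonsingular W b"
  unfolding nonsingular_def
proof (intro allI impI ballI)
  fix x w assume x: "\<forall>t\<in>W. x (b t 2) \<longleftrightarrow> x (b t 0) \<noteq> x (b t 1)" and w: "w \<in> W"
  let ?E = "V \<times> {..<3::nat}"
  define mk where "mk = inv_into W (\<lambda>x. (pt x, lab x))"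
  have mk: "mk (pt z, lab z) = z" if "z \<in> W" for z
    unfolding mk_def using pt_lab that by (auto simp: bij_betw_def intro: inv_into_f_eq)
  have mk': "\<exists>z\<in>W. pt z = v \<and> lab z = f \<and> mk (v, f) = z" if "v \<in> V" "f \<subseteq> ?E" for v f
  proof -
    have "(v, f) \<in> (\<lambda>x. (pt x, lab x)) ` W" using pt_lab that by (auto simp: bij_betw_def)
    then show ?thesis using mk by blast
  qed
  have step: "mk (a t i, f \<triangle> {(t, i)}) = b z i"
    if "z \<in> W" "pt z = t" "lab z = f" "i < 3" for z t f i
    using mk[OF b_in[OF that(1,4)]] pt_b[OF that(1,4)] lab_b[OF that(1,4)] that(2,3) by simp
  have "\<not> x (mk (pt w, lab w))"
  proof (rule flip_invariant_zero[OF assms, where D = ?E and y = "\<lambda>v f. x (mk (v, f))"])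
    fix t f assume "t \<in> V" "f \<subseteq> ?E"
    then obtain z where z: "z \<in> W" "pt z = t" "lab z = f" using mk' by blast
    show "x (mk (a t 2, f \<triangle> {(t, 2)})) \<longleftrightarrow> x (mk (a t 0, f \<triangle> {(t, 0)})) \<noteq> x (mk (a t 1, f \<triangle> {(t, 1)}))"
      using x z(1) step[OF z, of 0] step[OF z, of 1] step[OF z, of 2] by simp
  next
    show "finite ?E" using base by (simp add: triple_system_def)
    show "lab w \<subseteq> ?E" using pt_lab w by (auto simp: bij_betw_def)
  qed (use pt_in w in auto)
  then show "\<not> x w" using mk[OF w] by simp
qed

end

text \<open>Each lift changes the type of the vertices; coding them back into \<open>nat\<close>
  lets the construction be iterated by induction.\<close>

lemma lift_exists:
  fixes a :: "nat \<Rightarrow> nat \<Rightarrow> nat"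
  assumes "triple_system V a" "nonsingular V a" "locally_forest n V a"
  shows "\<exists>(W :: nat set) b. triple_system W b \<and> nonsingular W b \<and> locally_forest (Suc n) W b"
proof -
  let ?P = "V \<times> Pow (V \<times> {..<3::nat})"
  have aV: "a t i \<in> V" if "t \<in> V" "i < 3" for t i
    using assms(1) that by (auto simp: triple_system_def neighbours_def)
  have "finite ?P" using assms(1) by (simp add: triple_system_def)
  then obtain h where h: "bij_betw h ?P {0..<card ?P}" using ex_bij_betw_finite_nat by blast
  define W where "W = {0..<card ?P}"
  define g where "g = inv_into ?P h"
  define b where "b x i = h (a (fst (g x)) i, snd (g x) \<triangle> {(fst (g x), i)})" for x i
  have g: "bij_betw g W ?P" unfolding g_def W_def by (rule bij_betw_inv_into[OF h])
  have hg: "g (h z) = z" "h z \<in> W" if "z \<in> ?P" for z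
    using bij_betw_inv_into_left[OF h that] bij_betwE[OF h] that by (auto simp: g_def W_def)
  have gP: "(a (fst (g x)) i, snd (g x) \<triangle> {(fst (g x), i)}) \<in> ?P" if "x \<in> W" "i < 3" for x i
  proof -
    have "g x \<in> ?P" using bij_betwE[OF g] that(1) by blast
    then show ?thesis using aV that(2) by (cases "g x") auto
  qed
  interpret parity_lift V a W b "\<lambda>x. fst (g x)" "\<lambda>x. snd (g x)"
  proof
    show "bij_betw (\<lambda>x. (fst (g x), snd (g x))) W ?P" using g by simp
    fix x i assume x: "x \<in> W" "i < (3::nat)"
    note gb = hg[OF gP[OF x], folded b_def]
    show "b x i \<in> W" by (rule gb(2))
    show "fst (g (b x i)) = a (fst (g x)) i" "snd (g (b x i)) = snd (g x) \<triangle> {(fst (g x), i)}"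
      by (simp_all add: gb(1))
  qed (fact assms(1))
  show ?thesis
    using lift_triple_system lift_nonsingular[OF assms(2)] lift_locally_forest[OF assms(3)] by blast
qed

text \<open>The matrix is multiplication by 1 + z + z^2, up to inverting z, in F_2[z]/(z^4 - 1) =
  F_2[z]/(z + 1)^4. It is a unit because its value at z = 1 is 1. For n = 0 the forest condition is
  vacuous.\<close>

lemma base_exists:
  "\<exists>(V :: nat set) a. triple_system V a \<and> nonsingular V a \<and> locally_forest 0 V a"
proof (intro exI conjI)
  let ?V = "{0, 1, 2, 3} :: nat set" and ?a = "\<lambda>t i. (t + i) mod 4 :: nat"
  have three: "{..<3} = {0, 1, 2 :: nat}" by auto
  show "triple_system ?V ?a" by (auto simp: triple_system_def neighbours_def three)
  show "nonsingular ?V ?a"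
    unfolding nonsingular_def
  proof (intro allI impI)
    fix x assume *: "\<forall>t\<in>?V. x (?a t 2) \<longleftrightarrow> x (?a t 0) \<noteq> x (?a t 1)"
    have "x 2 \<longleftrightarrow> x 0 \<noteq> x 1" using bspec[OF *, of 0] by (simp flip: numeral_2_eq_2)
    moreover have "x 3 \<longleftrightarrow> x 1 \<noteq> x 2" using bspec[OF *, of 1] by (simp flip: numeral_2_eq_2)
    moreover have "x 0 \<longleftrightarrow> x 2 \<noteq> x 3" using bspec[OF *, of 2] by (simp flip: numeral_2_eq_2)
    moreover have "x 1 \<longleftrightarrow> x 3 \<noteq> x 0" using bspec[OF *, of 3] by (simp flip: numeral_2_eq_2)
    ultimately have "\<not> x 0 \<and> \<not> x 1 \<and> \<not> x 2 \<and> \<not> x 3" by argo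
    then show "\<forall>v\<in>?V. \<not> x v" by simp
  qed
  show "locally_forest 0 ?V ?a" by (simp add: locally_forest_def)
qed

theorem nonsingular_locally_forest_exists:
  "\<exists>(V :: nat set) a. triple_system V a \<and> nonsingular V a \<and> locally_forest n V a"
proof (induction n)
  case 0
  then show ?case by (rule base_exists)
next
  case (Suc n)
  then show ?case using lift_exists by blast
qed

section \<open>Locally consistent assignments\<close>

text \<open>The boundary of \<open>Y\<close> is the support of the sum of the equations in \<open>Y\<close>.\<close>

definition boundary :: "('v \<Rightarrow> nat \<Rightarrow> 'v) \<Rightarrow> 'v set \<Rightarrow> 'v set" where
  "boundary a Y = {v. odd (card {t \<in> Y. v \<in> neighbours a t})}"

definition consistent :: "nat \<Rightarrow> 'v set \<Rightarrow> ('v \<Rightarrow> nat \<Rightarrow> 'v) \<Rightarrow> 'v set \<Rightarrow> ('v \<Rightarrow> bool) \<Rightarrow> bool" where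
  "consistent n V a S c \<longleftrightarrow>
     (\<forall>Y\<subseteq>V. card Y \<le> n \<longrightarrow> boundary a Y \<subseteq> S \<longrightarrow> even (card {v \<in> boundary a Y. c v}))"

lemma even_card_sym_diff:
  assumes "finite X" "finite Y"
  shows "even (card (X \<triangle> Y)) \<longleftrightarrow> even (card X) = even (card Y)"
proof -
  have "card (X \<triangle> Y) = card (X - Y) + card (Y - X)"
    using assms by (intro card_Un_disjoint) auto
  moreover have "card X = card (X - Y) + card (X \<inter> Y)" "card Y = card (Y - X) + card (X \<inter> Y)"
    using assms card_Diff_subset_Int[of X Y] card_Diff_subset_Int[of Y X]
      card_mono[of X "X \<inter> Y"] card_mono[of Y "X \<inter> Y"] by (simp_all add: Int_commute)
  ultimately show ?thesis by auto
qed

section \<open>Linearity of the boundary and expansion of small sets\<close>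

lemma boundary_empty: "boundary a {} = {}"
  by (simp add: boundary_def)

lemma boundary_singleton: "boundary a {t} = neighbours a t"
proof -
  have "{s \<in> {t}. v \<in> neighbours a s} = (if v \<in> neighbours a t then {t} else {})" for v by auto
  then show ?thesis by (simp add: boundary_def)
qed

lemma boundary_sym_diff:
  assumes "finite Y" "finite Z"
  shows "boundary a (Y \<triangle> Z) = boundary a Y \<triangle> boundary a Z"
proof -
  have "{t \<in> Y \<triangle> Z. v \<in> neighbours a t} =
      {t \<in> Y. v \<in> neighbours a t} \<triangle> {t \<in> Z. v \<in> neighbours a t}" for v by auto
  then have "v \<in> boundary a (Y \<triangle> Z) \<longleftrightarrow> v \<in> boundary a Y \<triangle> boundary a Z" for v
    using even_card_sym_diff[of "{t \<in> Y. v \<in> neighbours a t}" "{t \<in> Z. v \<in> neighbours a t}"] assms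
    by (simp add: boundary_def) blast
  then show ?thesis by blast
qed

lemma boundary_incident: "v \<in> boundary a Y \<Longrightarrow> \<exists>t\<in>Y. v \<in> neighbours a t"
proof (rule ccontr)
  assume v: "v \<in> boundary a Y" and "\<not> (\<exists>t\<in>Y. v \<in> neighbours a t)"
  then have "{t \<in> Y. v \<in> neighbours a t} = {}" by blast
  then show False using v unfolding boundary_def mem_Collect_eq by (metis card.empty even_zero)
qed

lemma finite_neighbours: "finite (neighbours a t)"
  by (simp add: neighbours_def)

lemma finite_boundary: "finite Y \<Longrightarrow> finite (boundary a Y)"
proof -
  assume "finite Y"
  moreover have "boundary a Y \<subseteq> (\<Union>t\<in>Y. neighbours a t)" using boundary_incident by fast
  ultimately show ?thesis using finite_neighbours finite_subset by (metis (no_types) finite_UN)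
qed

lemma neighbours_three: "neighbours a t = {a t 0, a t 1, a t 2}"
proof -
  have "{..<3} = {0, 1, 2 :: nat}" by auto
  then show ?thesis by (simp add: neighbours_def)
qed

lemma card_neighbours: "triple_system V a \<Longrightarrow> t \<in> V \<Longrightarrow> card (neighbours a t) = 3"
  by (auto simp: triple_system_def neighbours_def card_image)

lemma card_neighbours_le: "card (neighbours a t) \<le> 3"
  using card_image_le[of "{..<3::nat}" "a t"] by (simp add: neighbours_def)

text \<open>Remove a leaf \<open>t\<close>. Only the vertex \<open>u\<close> can cancel, so the
  boundary of the rest loses at most one element, while \<open>t\<close> contributes at least
  two.\<close>

lemma card_le_boundary:
  assumes sys: "triple_system V a" and forest: "locally_forest n V a"
    and "Y \<subseteq> V" "card Y \<le> n"
  shows "card Y \<le> card (boundary a Y)"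
  using assms(3,4)
proof (induction "card Y" arbitrary: Y)
  case (Suc k)
  have "finite Y" using Suc(2) card_ge_0_finite[of Y] by simp
  show ?case
  proof (cases k)
    case 0
    then obtain t where "Y = {t}" using Suc(2) card_1_singletonE[of Y] by auto
    then show ?thesis using Suc(3) card_neighbours[OF sys] by (simp add: boundary_singleton)
  next
    case (Suc m)
    then have "two_leaves a Y"
      using forest Suc.hyps(2) Suc.prems unfolding locally_forest_def by simp
    then obtain t u where t: "t \<in> Y" "shared a Y t \<subseteq> {u}"
      unfolding two_leaves_def leaf_def by blast
    let ?Z = "Y - {t}" and ?N = "neighbours a t"
    have "k = card ?Z" using Suc.hyps(2) t(1) \<open>finite Y\<close> by simp
    then have IH: "k \<le> card (boundary a ?Z)" using Suc.hyps(1)[of ?Z] Suc.prems Suc.hyps(2) by auto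
    have "?Z \<triangle> {t} = Y" using t(1) by auto
    then have bY: "boundary a Y = boundary a ?Z \<triangle> ?N"
      using boundary_sym_diff[of ?Z "{t}" a] \<open>finite Y\<close> by (simp add: boundary_singleton)
    have disj: "(boundary a ?Z - {u}) \<inter> (?N - {u}) = {}"
      using boundary_incident[of _ a ?Z] t(2) unfolding shared_def by fast
    have fin: "finite (boundary a ?Z)" "finite (boundary a Y)"
      using finite_boundary \<open>finite Y\<close> by auto
    have "k - 1 \<le> card (boundary a ?Z - {u})"
      using IH card_Diff_singleton_if[of "boundary a ?Z" u] fin(1) by auto
    moreover have "2 \<le> card (?N - {u})"
      using card_neighbours[OF sys, of t] t(1) Suc.prems card_Diff_singleton_if[of ?N u] finite_neighbours[of a t]
      by (auto simp: subset_iff)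
    moreover have "card ((boundary a ?Z - {u}) \<union> (?N - {u})) \<le> card (boundary a Y)"
      using disj bY by (intro card_mono[OF fin(2)]) blast
    then have "card (boundary a ?Z - {u}) + card (?N - {u}) \<le> card (boundary a Y)"
      using card_Un_disjoint[OF _ _ disj] fin finite_neighbours[of a t] by simp
    ultimately show ?thesis using Suc.hyps(2) by linarith
  qed
qed simp

lemma consistent_mono: "consistent n V a S c \<Longrightarrow> T \<subseteq> S \<Longrightarrow> consistent n V a T c"
  unfolding consistent_def by (meson subset_trans)

lemma consistent_row:
  assumes "triple_system V a" "consistent n V a S c" "1 \<le> n" "t \<in> V" "neighbours a t \<subseteq> S"
  shows "c (a t 2) \<longleftrightarrow> c (a t 0) \<noteq> c (a t 1)"
proof -
  have inj: "inj_on (a t) {..<3}" using assms(1,4) by (simp add: triple_system_def)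
  have "a t 0 \<noteq> a t 1" "a t 0 \<noteq> a t 2" "a t 1 \<noteq> a t 2"
    using inj_onD[OF inj, of 0 1] inj_onD[OF inj, of 0 2] inj_onD[OF inj, of 1 2] by auto
  moreover have "{v \<in> neighbours a t. c v} =
      (if c (a t 0) then {a t 0} else {}) \<union> (if c (a t 1) then {a t 1} else {}) \<union>
      (if c (a t 2) then {a t 2} else {})"
    unfolding neighbours_three by auto
  moreover have "even (card {v \<in> neighbours a t. c v})"
    using assms(2)[unfolded consistent_def, rule_format, of "{t}"] assms(3-5)
    by (simp add: boundary_singleton)
  ultimately show ?thesis by (auto split: if_splits)
qed

text \<open>Two small sets of equations that determine the value at \<open>v\<close> from \<open>S\<close> agree about it, since their
  symmetric difference has boundary in \<open>S\<close> and, by \<open>card_le_boundary\<close>, is still small.\<close>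

lemma consistent_extend:
  assumes sys: "triple_system V a" and forest: "locally_forest n V a"
    and cons: "consistent n V a S c" and S: "finite S" "2 * Suc (card S) \<le> n"
  shows "\<exists>c'. consistent n V a (insert v S) c' \<and> (\<forall>u\<in>S. c' u = c u)"
proof (cases "v \<notin> S \<and> (\<exists>Y\<subseteq>V. card Y \<le> n \<and> boundary a Y \<subseteq> insert v S \<and> v \<in> boundary a Y)")
  case False
  \<comment> \<open>No small sum involves a new \<open>v\<close>, so its present value will
    do.\<close>
  then have "boundary a Y \<subseteq> S"
    if "Y \<subseteq> V" "card Y \<le> n" "boundary a Y \<subseteq> insert v S" for Y
    using that by (metis subset_insert insert_absorb)
  then have "consistent n V a (insert v S) c" using cons unfolding consistent_def by simp
  then show ?thesis by blast
next
  case True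
  then obtain Z where Z: "Z \<subseteq> V" "card Z \<le> n" "boundary a Z \<subseteq> insert v S" "v \<in> boundary a Z"
    by blast
  have finV: "finite V" using sys by (simp add: triple_system_def)
  have fin: "finite Y" "finite (boundary a Y)" if "Y \<subseteq> V" for Y
    using finite_subset[OF that finV] finite_boundary by auto
  \<comment> \<open>The expansion bound improves \<open>n\<close> to \<open>Suc (card S)\<close>.
    Two such sets then have a symmetric difference of at most \<open>n\<close> equations, which is
    why twice this number is required of \<open>n\<close>.\<close>
  have small: "card Y \<le> Suc (card S)" if "Y \<subseteq> V" "card Y \<le> n" "boundary a Y \<subseteq> insert v S" for Y
  proof -
    have "card Y \<le> card (boundary a Y)" by (rule card_le_boundary[OF sys forest that(1,2)])
    also have "\<dots> \<le> card (insert v S)" by (rule card_mono) (use S that in auto)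
    also have "\<dots> \<le> Suc (card S)" by (simp add: card_insert_if S)
    finally show ?thesis .
  qed
  define c' where "c' = c(v := odd (card {u \<in> boundary a Z - {v}. c u}))"
  have c'S: "c' u = c u" if "u \<in> S" for u using that True by (auto simp: c'_def)
  have Z_even: "even (card {u \<in> boundary a Z. c' u})"
  proof -
    have eq: "{u \<in> boundary a Z. c' u} = {u \<in> boundary a Z - {v}. c u} \<union> (if c' v then {v} else {})"
      using Z(4) by (auto simp: c'_def)
    have "finite {u \<in> boundary a Z - {v}. c u}" using fin[OF Z(1)] by simp
    then show ?thesis unfolding eq by (auto simp: c'_def)
  qed
  have "even (card {u \<in> boundary a Y. c' u})"
    if Y: "Y \<subseteq> V" "card Y \<le> n" "boundary a Y \<subseteq> insert v S" for Y
  proof -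
    have even_S: "even (card {u \<in> boundary a X. c' u})"
      if "X \<subseteq> V" "card X \<le> n" "boundary a X \<subseteq> S" for X
    proof -
      have "{u \<in> boundary a X. c' u} = {u \<in> boundary a X. c u}" using that(3) c'S by blast
      then show ?thesis using cons that unfolding consistent_def by simp
    qed
    show ?thesis
    proof (cases "v \<in> boundary a Y")
      case True
      have bd: "boundary a (Y \<triangle> Z) = boundary a Y \<triangle> boundary a Z"
        by (rule boundary_sym_diff) (use fin Y(1) Z(1) in auto)
      have "card (Y \<triangle> Z) \<le> card (Y \<union> Z)"
        by (rule card_mono) (use fin Y(1) Z(1) in auto)
      also have "\<dots> \<le> card Y + card Z" by (rule card_Un_le)
      also have "\<dots> \<le> n" using small[OF Y] small[OF Z(1-3)] S(2) by simp
      finally have "even (card {u \<in> boundary a (Y \<triangle> Z). c' u})"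
        using even_S[of "Y \<triangle> Z"] bd True Z Y by blast
      moreover have "{u \<in> boundary a (Y \<triangle> Z). c' u} =
          {u \<in> boundary a Y. c' u} \<triangle> {u \<in> boundary a Z. c' u}"
        unfolding bd by blast
      ultimately show ?thesis
        using Z_even even_card_sym_diff[of "{u \<in> boundary a Y. c' u}" "{u \<in> boundary a Z. c' u}"]
          fin(2)[OF Y(1)] fin(2)[OF Z(1)] by simp
    next
      case False
      then show ?thesis using even_S Y by blast
    qed
  qed
  then have "consistent n V a (insert v S) c'" unfolding consistent_def by blast
  then show ?thesis using c'S by blast
qed

lemma consistent_extend_finite:
  assumes "triple_system V a" "locally_forest n V a" "consistent n V a S c" "finite S"
    "finite T" "2 * (card S + card T) \<le> n"
  shows "\<exists>c'. consistent n V a (S \<union> T) c' \<and> (\<forall>u\<in>S. c' u = c u)"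
  using assms(5,6)
proof (induction T rule: finite_induct)
  case (insert v T)
  then obtain c1 where c1: "consistent n V a (S \<union> T) c1" "\<forall>u\<in>S. c1 u = c u" by auto
  have "2 * Suc (card (S \<union> T)) \<le> n" using card_Un_le[of S T] insert by simp
  then obtain c2 where "consistent n V a (insert v (S \<union> T)) c2" "\<forall>u\<in>S \<union> T. c2 u = c1 u"
    using consistent_extend[OF assms(1,2) c1(1)] insert(1) assms(4) by (metis finite_UnI)
  then show ?case using c1(2) by (intro exI[of _ c2]) auto
qed (use assms(3) in auto)

section \<open>The pair of instances\<close>

text \<open>In a homomorphism to \<open>QX\<close>, the indicator of the elements of minimal value sums to zero over each
  constraint. Normalising to \<open>One\<close> being minimal, exactly one of \<open>Foot v False\<close>, \<open>Foot v True\<close> is,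
  and \<open>x\<^sub>v\<close> is the indicator of \<open>Foot v False\<close>; the parameter \<open>\<beta>\<close> prescribes \<open>x\<^sub>p\<close>.
  The equation of \<open>t\<close> is \<open>Foot (a t 0) i + Foot (a t 1) j + Foot (a t 2) (i = j) = One\<close>,
  which \<open>Aux t i j\<close> breaks up into ternary constraints.\<close>

datatype 'v elt = One | Foot 'v bool | Aux 'v bool bool

instance elt :: (countable) countable by countable_datatype

definition elts :: "'v set \<Rightarrow> 'v elt set" where
  "elts V = insert One ((\<lambda>(v, i). Foot v i) ` (V \<times> UNIV) \<union> (\<lambda>(t, i, j). Aux t i j) ` (V \<times> UNIV))"

text \<open>The first three families range over all Booleans so as to be symmetric under exchanging
  feet; only \<open>root\<close> breaks the symmetry. Its repeated \<open>One\<close> forces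
  \<open>Foot p \<beta>\<close> strictly above \<open>One\<close>, hence not minimal.\<close>

inductive_set constraints :: "'v set \<Rightarrow> ('v \<Rightarrow> nat \<Rightarrow> 'v) \<Rightarrow> 'v \<Rightarrow> bool \<Rightarrow> 'v elt list set"
  for V a p \<beta> where
  feet: "v \<in> V \<Longrightarrow> [Foot v i, Foot v (\<not> i), One] \<in> constraints V a p \<beta>"
| left: "t \<in> V \<Longrightarrow> [Foot (a t 0) i, Foot (a t 1) j, Aux t i j] \<in> constraints V a p \<beta>"
| right: "t \<in> V \<Longrightarrow> [Aux t i j, Foot (a t 2) (i = j), One] \<in> constraints V a p \<beta>"
| root: "[One, One, Foot p \<beta>] \<in> constraints V a p \<beta>"

definition inst :: "'v set \<Rightarrow> ('v \<Rightarrow> nat \<Rightarrow> 'v) \<Rightarrow> 'v \<Rightarrow> bool \<Rightarrow> (X_symbol, 'v elt) rel_struct" where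
  "inst V a p \<beta> = \<lparr>universe = elts V, interp = (\<lambda>_. constraints V a p \<beta>)\<rparr>"

section \<open>Solvability of the two instances\<close>

lemma elts_simps [simp]:
  "One \<in> elts V" "Foot v i \<in> elts V \<longleftrightarrow> v \<in> V" "Aux t i j \<in> elts V \<longleftrightarrow> t \<in> V"
  by (auto simp: elts_def image_iff)

lemma finite_elts: "finite V \<Longrightarrow> finite (elts V)"
  by (simp add: elts_def)

lemma finite_struct_inst:
  assumes "triple_system V a" "p \<in> V"
  shows "finite_struct X_sig (inst V a p \<beta>)"
proof -
  have aV: "a t i \<in> V" if "t \<in> V" "i < 3" for t i
    using assms(1) that by (auto simp: triple_system_def neighbours_def)
  have "length xs = 3 \<and> set xs \<subseteq> elts V" if "xs \<in> constraints V a p \<beta>" for xs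
    using that by cases (use aV assms(2) in auto)
  moreover have "elts V \<noteq> {}" by (auto simp: elts_def)
  moreover have "finite V" using assms(1) by (simp add: triple_system_def)
  ultimately show ?thesis
    by (auto simp: finite_struct_def is_struct_def inst_def X_sig_def finite_elts split: if_splits)
qed

text \<open>Realises the zero solution: \<open>One\<close> and every \<open>Foot v True\<close> get
  the minimum 0. The value 2 occurs where both feet are 1, as equal arguments need a strictly larger
  third.\<close>

lemma inst_False_in_CSP:
  assumes "triple_system V a" "p \<in> V"
  shows "inst V a p False \<in> CSP X_sig QX"
proof -
  define h :: "'a elt \<Rightarrow> rat" where
    "h e = (case e of One \<Rightarrow> 0 | Foot v i \<Rightarrow> (if i then 0 else 1)
       | Aux t i j \<Rightarrow> (if i then (if j then 1 else 0) else (if j then 0 else 2)))" for e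
  have "map h xs \<in> interp QX X_sym" if "xs \<in> constraints V a p False" for xs
    using that by cases (auto simp: h_def QX_def)
  then have "is_hom X_sig (inst V a p False) QX h"
    by (auto simp: is_hom_def inst_def X_sig_def QX_def split: if_splits)
  then show ?thesis using finite_struct_inst[OF assms] by (auto simp: CSP_def)
qed

lemma inst_True_not_in_CSP:
  assumes sys: "triple_system V a" and ns: "nonsingular V a" and p: "p \<in> V"
  shows "inst V a p True \<notin> CSP X_sig QX"
proof
  assume "inst V a p True \<in> CSP X_sig QX"
  then obtain h where h: "is_hom X_sig (inst V a p True) QX h" by (auto simp: CSP_def)
  have aV: "a t i \<in> V" if "t \<in> V" "i < 3" for t i
    using sys that by (auto simp: triple_system_def neighbours_def)
  have "finite V" using sys by (simp add: triple_system_def)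
  then have fin: "finite (h ` elts V)" by (intro finite_imageI finite_elts)
  define F where "F e \<longleftrightarrow> h e = Min (h ` elts V)" for e
  have "Min (h ` elts V) \<in> h ` elts V" by (rule Min_in[OF fin]) (use elts_simps(1) in blast)
  then obtain e where e: "e \<in> elts V" "F e" by (auto simp: F_def)
  have min: "Min (h ` elts V) \<le> h e" if "e \<in> elts V" for e using fin that by simp
  have parity: "F e3 \<longleftrightarrow> F e1 \<noteq> F e2"
    if c: "[e1, e2, e3] \<in> constraints V a p True" and el: "e1 \<in> elts V" "e2 \<in> elts V" "e3 \<in> elts V"
    for e1 e2 e3
  proof -
    have "X_sig X_sym = Some 3" by (simp add: X_sig_def)
    then have "\<forall>xs\<in>constraints V a p True. map h xs \<in> interp QX X_sym"
      using h unfolding is_hom_def inst_def by simp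
    then have "map h [e1, e2, e3] \<in> interp QX X_sym" using c by blast
    then show ?thesis using min[OF el(1)] min[OF el(2)] min[OF el(3)]
      by (auto simp: QX_def F_def)
  qed
  define x where "x v \<longleftrightarrow> F (Foot v False)" for v
  have foot: "F (Foot v True) \<longleftrightarrow> x v \<noteq> F One" if "v \<in> V" for v
    using parity[OF constraints.feet[OF that, where i = False]] that by (auto simp: x_def)
  \<comment> \<open>\<open>F One\<close> cancels: it enters through \<open>right\<close> and again
    through the foot \<open>True\<close> of \<open>a t 2\<close>. So \<open>x\<close> is in the
    kernel whether or not \<open>One\<close> is minimal.\<close>
  have "x (a t 2) \<longleftrightarrow> x (a t 0) \<noteq> x (a t 1)" if t: "t \<in> V" for t
    using parity[OF constraints.left[OF t, where i = False and j = False]]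
      parity[OF constraints.right[OF t, where i = False and j = False]]
      foot[OF aV[OF t], of 2] aV[OF t] t by (auto simp: x_def)
  then have x0: "\<not> x v" if "v \<in> V" for v using ns that unfolding nonsingular_def by blast
  \<comment> \<open>With every \<open>x v\<close> false, \<open>root\<close> makes
    \<open>One\<close> non-minimal, and then nothing is left to attain the minimum.\<close>
  have "\<not> F (Foot p True)" using parity[OF constraints.root] p by simp
  then have one: "\<not> F One" using foot[OF p] x0[OF p] by blast
  then have feet: "\<not> F (Foot v i)" if "v \<in> V" for v i
    using foot[OF that] x0[OF that] by (cases i) (auto simp: x_def)
  then have "\<not> F (Aux t i j)" if "t \<in> V" for t i j
    using parity[OF constraints.left[OF that, where i = i and j = j]] aV[OF that] that by simp
  then show False using one feet e by (cases e) auto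
qed

section \<open>Duplicator's strategy\<close>

text \<open>For \<open>Aux\<close> it includes \<open>a t 2\<close>, which \<open>shift\<close> does
  not read, so that the whole equation of \<open>t\<close> is under control once
  \<open>Aux t i j\<close> is pebbled.\<close>

fun support :: "('v \<Rightarrow> nat \<Rightarrow> 'v) \<Rightarrow> 'v elt \<Rightarrow> 'v set" where
  "support a One = {}"
| "support a (Foot v i) = {v}"
| "support a (Aux t i j) = neighbours a t"

fun shift :: "('v \<Rightarrow> nat \<Rightarrow> 'v) \<Rightarrow> ('v \<Rightarrow> bool) \<Rightarrow> 'v elt \<Rightarrow> 'v elt" where
  "shift a c One = One"
| "shift a c (Foot v i) = Foot v (i \<noteq> c v)"
| "shift a c (Aux t i j) = Aux t (i \<noteq> c (a t 0)) (j \<noteq> c (a t 1))"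

lemma shift_shift [simp]: "shift a c (shift a c e) = e"
  by (cases e) auto

lemma support_shift [simp]: "support a (shift a c e) = support a e"
  by (cases e) auto

lemma shift_in_elts [simp]: "shift a c e \<in> elts V \<longleftrightarrow> e \<in> elts V"
  by (cases e) auto

lemma shift_cong: "(\<And>v. v \<in> support a e \<Longrightarrow> c v = c' v) \<Longrightarrow> shift a c e = shift a c' e"
  by (cases e) (auto simp: neighbours_three)

lemma finite_support: "finite (support a e)" and card_support: "card (support a e) \<le> 3"
  by (cases e; simp add: finite_neighbours card_neighbours_le)+

text \<open>Adding a solution \<open>c\<close> with x_p = 1 would carry one instance to the other.
  No such solution exists globally, but only \<open>right\<close> uses an equation of
  \<open>c\<close>, and only one whose vertices lie in \<open>S\<close>.\<close>

lemma shift_constraints: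
  assumes "xs \<in> constraints V a p \<beta>" and sys: "triple_system V a"
    and c: "consistent n V a S c" "1 \<le> n" "c p" and "\<And>e. e \<in> set xs \<Longrightarrow> support a e \<subseteq> S"
  shows "map (shift a c) xs \<in> constraints V a p (\<not> \<beta>)"
  using assms(1)
proof cases
  case (feet v i)
  then show ?thesis using constraints.feet[of v V "i \<noteq> c v" a p "\<not> \<beta>"] by (cases "c v") auto
next
  case (left t i j)
  then show ?thesis using constraints.left[of t V a _ _ p "\<not> \<beta>"] by simp
next
  case (right t i j)
  have "neighbours a t \<subseteq> S" using assms(6)[of "Aux t i j"] right by simp
  then have "((i = j) \<noteq> c (a t 2)) = ((i \<noteq> c (a t 0)) = (j \<noteq> c (a t 1)))"
    using consistent_row[OF sys c(1,2) right(2)] by auto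
  then show ?thesis
    using right constraints.right[of t V "i \<noteq> c (a t 0)" "j \<noteq> c (a t 1)" a p "\<not> \<beta>"] by simp
next
  case root
  then show ?thesis using constraints.root c(3) by simp
qed

text \<open>\<open>p\<close> is always included, so that extending the assignment never changes the
  value \<open>c p\<close>.\<close>

definition touched :: "('v \<Rightarrow> nat \<Rightarrow> 'v) \<Rightarrow> 'v \<Rightarrow> ('v elt \<times> 'v elt) set \<Rightarrow> 'v set" where
  "touched a p r = insert p (\<Union>(e, _)\<in>r. support a e)"

definition positions :: "nat \<Rightarrow> 'v set \<Rightarrow> ('v \<Rightarrow> nat \<Rightarrow> 'v) \<Rightarrow> 'v \<Rightarrow> ('v elt \<times> 'v elt) set set" where
  "positions n V a p = {r. finite r \<and> (\<exists>c. c p \<and> consistent n V a (touched a p r) c \<and>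
     (\<forall>(e, e')\<in>r. e \<in> elts V \<and> e' = shift a c e))}"

lemma finite_touched: "finite r \<Longrightarrow> finite (touched a p r)"
  by (auto simp: touched_def finite_support)

lemma card_touched: "finite r \<Longrightarrow> card (touched a p r) \<le> 3 * card r + 1"
proof (induction r rule: finite_induct)
  case (insert z r)
  have "touched a p (insert z r) = touched a p r \<union> support a (fst z)"
    by (auto simp: touched_def)
  then have "card (touched a p (insert z r)) \<le> card (touched a p r) + card (support a (fst z))"
    by (simp add: card_Un_le)
  then show ?case using insert card_support[of a "fst z"] by simp
qed (simp add: touched_def)

lemma positions_extend:
  assumes sys: "triple_system V a" and forest: "locally_forest n V a" and n: "6 * K + 2 \<le> n"
    and r: "r \<in> positions n V a p" and "card r < K"
  shows "\<exists>f. bij_betw f (elts V) (elts V) \<and> (\<forall>e\<in>elts V. insert (e, f e) r \<in> positions n V a p)"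
proof -
  let ?S = "touched a p r"
  obtain c where c: "finite r" "c p" "consistent n V a ?S c"
    "\<And>e e'. (e, e') \<in> r \<Longrightarrow> e \<in> elts V \<and> e' = shift a c e"
    using r by (auto simp: positions_def)
  \<comment> \<open>At most K - 1 pairs touch at most 3(K - 1) + 1 vertices, and the new element
    adds at most 3. Twice the total is 6K + 2.\<close>
  have "\<exists>c'. consistent n V a (?S \<union> support a e) c' \<and> (\<forall>u\<in>?S. c' u = c u)" for e
    by (rule consistent_extend_finite[OF sys forest c(3)])
      (use finite_touched[OF c(1)] finite_support card_touched[OF c(1), of a p] card_support[of a e]
        n assms(5) in auto)
  then have ex: "\<exists>c'. consistent n V a (?S \<union> T) c' \<and> (\<forall>u\<in>?S. c' u = c u)" if "T \<in> range (support a)" for T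
    using that by auto
  \<comment> \<open>The assignment depends on the support of the element alone. As
    \<open>shift\<close> preserves supports, \<open>f\<close> is an involution and hence a
    bijection.\<close>
  define C where "C T = (SOME c'. consistent n V a (?S \<union> T) c' \<and> (\<forall>u\<in>?S. c' u = c u))" for T
  have C: "consistent n V a (?S \<union> support a e) (C (support a e))" "\<forall>u\<in>?S. C (support a e) u = c u" for e
    using someI_ex[OF ex[of "support a e"]] unfolding C_def by auto
  define f where "f e = shift a (C (support a e)) e" for e
  have "bij_betw f (elts V) (elts V)"
    by (rule bij_betw_byWitness[where f' = f]) (auto simp: f_def)
  moreover have "insert (e, f e) r \<in> positions n V a p" if e: "e \<in> elts V" for e
  proof -
    let ?c = "C (support a e)"
    have "touched a p (insert (e, f e) r) = ?S \<union> support a e" by (auto simp: touched_def)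
    moreover have "shift a c e0 = shift a ?c e0" if "(e0, e') \<in> r" for e0 e'
      using C(2)[of e] that by (intro shift_cong) (auto simp: touched_def)
    moreover have "?c p" using C(2)[of e] c(2) by (simp add: touched_def)
    ultimately show ?thesis
      using c(1,4) C(1)[of e] e by (auto simp: positions_def f_def intro!: exI[of _ ?c])
  qed
  ultimately show ?thesis by blast
qed

lemma inst_pebble_game:
  assumes sys: "triple_system V a" and forest: "locally_forest n V a" and n: "6 * K + 2 \<le> n"
  shows "pebble_game (inst V a p False) (inst V a p True) (positions n V a p) K"
proof
  show "card (universe (inst V a p False)) = card (universe (inst V a p True))"
    by (simp add: inst_def)
next
  \<comment> \<open>No nonempty small sum is supported on \<open>p\<close> alone: by expansion it
    would be a single equation, and that has three vertices. So x_p = 1 is locally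
    consistent.\<close>
  have "even (card {v \<in> boundary a Y. True})" if Y: "Y \<subseteq> V" "card Y \<le> n" "boundary a Y \<subseteq> {p}" for Y
  proof -
    have "finite Y" using Y(1) sys finite_subset by (auto simp: triple_system_def)
    have "card Y \<le> 1"
      using card_le_boundary[OF sys forest Y(1,2)] card_mono[OF _ Y(3)] by simp
    moreover have "Y \<noteq> {t}" for t
    proof
      assume "Y = {t}"
      then have "card (neighbours a t) \<le> 1" "t \<in> V"
        using card_mono[OF _ Y(3)] Y(1) by (simp_all add: boundary_singleton)
      then show False using card_neighbours[OF sys] by simp
    qed
    then have "card Y \<noteq> 1" using card_1_singletonE by blast
    ultimately have "card Y = 0" by linarith
    then have "Y = {}" using \<open>finite Y\<close> by simp
    then show ?thesis by (simp add: boundary_empty)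
  qed
  then have "consistent n V a {p} (\<lambda>_. True)" unfolding consistent_def by blast
  then show "{} \<in> positions n V a p" by (auto simp: positions_def touched_def)
next
  fix r q assume r: "r \<in> positions n V a p" and "q \<subseteq> r"
  then have "touched a p q \<subseteq> touched a p r" by (auto simp: touched_def)
  moreover obtain c where "finite r" "c p" "consistent n V a (touched a p r) c"
    "\<forall>(e, e')\<in>r. e \<in> elts V \<and> e' = shift a c e"
    using r by (auto simp: positions_def)
  ultimately show "q \<in> positions n V a p"
    using \<open>q \<subseteq> r\<close> consistent_mono[of n V a "touched a p r" c] finite_subset[of q r]
    unfolding positions_def by blast
next
  fix r assume "r \<in> positions n V a p"
  then show "r \<subseteq> universe (inst V a p False) \<times> universe (inst V a p True)"
    by (auto simp: positions_def inst_def)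
next
  fix r e d e' d' assume r: "r \<in> positions n V a p" "(e, d) \<in> r" "(e', d') \<in> r"
  then obtain c where "d = shift a c e" "d' = shift a c e'" by (auto simp: positions_def)
  then show "e = e' \<longleftrightarrow> d = d'" by (metis shift_shift)
next
  fix r xs ys R assume r: "r \<in> positions n V a p" and xs: "list_all2 (\<lambda>e d. (e, d) \<in> r) xs ys"
  obtain c where c: "c p" "consistent n V a (touched a p r) c"
    "\<And>e e'. (e, e') \<in> r \<Longrightarrow> e' = shift a c e"
    using r by (auto simp: positions_def)
  have "list_all2 (\<lambda>e d. d = shift a c e) xs ys" by (rule list_all2_mono[OF xs]) (rule c(3))
  then have ys: "ys = map (shift a c) xs" by (induction rule: list_all2_induct) simp_all
  have xs_eq: "xs = map (shift a c) ys" by (simp add: ys comp_def)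
  have supp: "support a e \<subseteq> touched a p r" if "e \<in> set xs" for e
  proof -
    have "\<exists>d. (e, d) \<in> r" using xs that by (induction rule: list_all2_induct) auto
    then show ?thesis by (auto simp: touched_def)
  qed
  have supp': "support a e \<subseteq> touched a p r" if "e \<in> set ys" for e
  proof -
    obtain d where "d \<in> set xs" "e = shift a c d" using \<open>e \<in> set ys\<close> unfolding ys by auto
    then show ?thesis using supp[of d] by simp
  qed
  have "1 \<le> n" using n by simp
  have "ys \<in> constraints V a p True" if "xs \<in> constraints V a p False"
    using shift_constraints[OF that sys c(2) \<open>1 \<le> n\<close> c(1) supp] by (simp add: ys)
  moreover have "xs \<in> constraints V a p False" if "ys \<in> constraints V a p True"
    using shift_constraints[OF that sys c(2) \<open>1 \<le> n\<close> c(1) supp'] unfolding xs_eq[symmetric] by simp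
  ultimately show "xs \<in> interp (inst V a p False) R \<longleftrightarrow> ys \<in> interp (inst V a p True) R"
    by (auto simp: inst_def)
next
  fix r assume "r \<in> positions n V a p" "card r < K"
  then show "\<exists>f. bij_betw f (universe (inst V a p False)) (universe (inst V a p True)) \<and>
      (\<forall>e\<in>universe (inst V a p False). insert (e, f e) r \<in> positions n V a p)"
    using positions_extend[OF sys forest n] by (simp add: inst_def)
qed (simp add: positions_def)

section \<open>Renaming elements\<close>

definition image_struct :: "('a \<Rightarrow> 'b) \<Rightarrow> ('r, 'a) rel_struct \<Rightarrow> ('r, 'b) rel_struct" where
  "image_struct f A = \<lparr>universe = f ` universe A, interp = (\<lambda>R. map f ` interp A R)\<rparr>"

text \<open>Isomorphism invariance as an instance of the game, with Duplicator always answering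
  along \<open>f\<close>. It moves the instances, built over \<open>elt\<close>, to the universe
  \<open>nat\<close> over which expressibility is defined.\<close>

lemma models_image_struct:
  assumes "inj f" "fpc_sentence \<tau> \<phi>"
  shows "models (image_struct f A) \<phi> \<longleftrightarrow> models A \<phi>"
proof -
  let ?Pos = "{r. finite r \<and> r \<subseteq> (\<lambda>a. (a, f a)) ` universe A}"
  interpret pebble_game A "image_struct f A" ?Pos "pebbles_fm \<phi>"
  proof
    have inj: "inj_on f (universe A)" using assms(1) inj_on_subset by blast
    show "card (universe A) = card (universe (image_struct f A))"
      using card_image[OF inj] by (simp add: image_struct_def)
    show "\<exists>g. bij_betw g (universe A) (universe (image_struct f A)) \<and>
        (\<forall>a\<in>universe A. insert (a, g a) r \<in> ?Pos)" if "r \<in> ?Pos" for r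
      using that inj by (intro exI[of _ f]) (auto simp: image_struct_def bij_betw_def)
    show "xs \<in> interp A R \<longleftrightarrow> ys \<in> interp (image_struct f A) R"
      if "r \<in> ?Pos" "list_all2 (\<lambda>a b. (a, b) \<in> r) xs ys" for r xs ys R
    proof -
      have "ys = map f xs" using that(2,1) by (induction rule: list_all2_induct) auto
      then show ?thesis using assms(1) by (auto simp: image_struct_def inj_image_mem_iff inj_mapI)
    qed
    show "a = a' \<longleftrightarrow> b = b'" if "r \<in> ?Pos" "(a, b) \<in> r" "(a', b') \<in> r" for r a b a' b'
    proof -
      have "b = f a" "b' = f a'" using that by auto
      then show ?thesis using assms(1) by (simp add: inj_eq)
    qed
  qed (auto simp: image_struct_def intro: finite_subset)
  show ?thesis using models_iff[OF assms(2)] by simp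
qed

lemma finite_struct_image_struct: "finite_struct \<tau> A \<Longrightarrow> finite_struct \<tau> (image_struct f A)"
  unfolding finite_struct_def is_struct_def image_struct_def by fastforce

lemma image_struct_in_CSP:
  assumes "inj f" "finite_struct \<tau> A"
  shows "image_struct f A \<in> CSP \<tau> B \<longleftrightarrow> A \<in> CSP \<tau> B"
proof
  assume "image_struct f A \<in> CSP \<tau> B"
  then obtain h where "is_hom \<tau> (image_struct f A) B h" by (auto simp: CSP_def)
  then have "is_hom \<tau> A B (h \<circ> f)"
    by (auto simp: is_hom_def image_struct_def image_image)
  then show "A \<in> CSP \<tau> B" using assms(2) by (auto simp: CSP_def)
next
  assume "A \<in> CSP \<tau> B"
  then obtain h where "is_hom \<tau> A B h" by (auto simp: CSP_def)
  then have "is_hom \<tau> (image_struct f A) B (h \<circ> inv f)"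
    using assms(1) by (auto simp: is_hom_def image_struct_def comp_def image_image)
  then show "image_struct f A \<in> CSP \<tau> B"
    using finite_struct_image_struct[OF assms(2)] by (auto simp: CSP_def)
qed

theorem theorem4p17: "\<not> CSP_expressible_in_FPC X_sig QX"
proof
  assume "CSP_expressible_in_FPC X_sig QX"
  then obtain \<phi> where \<phi>: "fpc_sentence X_sig \<phi>"
    "\<And>A :: (X_symbol, nat) rel_struct. finite_struct X_sig A \<Longrightarrow> models A \<phi> \<longleftrightarrow> A \<notin> CSP X_sig QX"
    unfolding CSP_expressible_in_FPC_def by blast
  define K where "K = pebbles_fm \<phi>"
  obtain V :: "nat set" and a where V: "triple_system V a" "nonsingular V a" "locally_forest (6 * K + 2) V a"
    using nonsingular_locally_forest_exists by blast
  then obtain p where p: "p \<in> V" by (auto simp: triple_system_def)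
  have "models (inst V a p \<beta>) \<phi> \<longleftrightarrow> inst V a p \<beta> \<notin> CSP X_sig QX" for \<beta>
  proof -
    note fin = finite_struct_inst[OF V(1) p, of \<beta>]
    show ?thesis
      using \<phi>(2)[OF finite_struct_image_struct[OF fin]]
        models_image_struct[OF inj_to_nat \<phi>(1)] image_struct_in_CSP[OF inj_to_nat fin] by blast
  qed
  moreover have "models (inst V a p False) \<phi> \<longleftrightarrow> models (inst V a p True) \<phi>"
    using pebble_game.models_iff[OF inst_pebble_game[OF V(1,3) order_refl] \<phi>(1)] by (simp add: K_def)
  ultimately show False
    using inst_False_in_CSP[OF V(1) p] inst_True_not_in_CSP[OF V(1,2) p] by blast
qed

end
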